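(* Let $(E,\rho)$ be a Polish metric space and $\Psi$ an $E$-valued time-homogeneous Markov process with transition semigroup $\{P(t)\}_{t\geq 0}$. Let $V:E\to[0,\infty)$ be continuous and assume: (a) $\{P(t)\}$ has a unique invariant probability measure $\mu_*$, and there are $\gamma>0$ and $C:\{\nu\in\mathcal{M}_1(E):\int V\,d\nu<\infty\}\to[0,\infty)$ with $d_{\mathrm{FM}}(\nu P(t),\mu_* )\leq C(\nu)e^{-\gamma t}$ for all $t\geq0$ and such $\nu$, where $C(\delta_x)=\varkappa(V(x)+1)^{1/2}$ for some $\varkappa>0$; (b) there exist $A,B\geq 0$, $\Gamma>0$ with $P(t)V^2(x)\leq Ae^{-\Gamma t}V^2(x)+B$ for all $x,t$. Let $g\in\operatorname{Lip}_b(E)$ be such that for every $x\in E$ the map $t\mapsto P(t)g(x)$ is continuous in some neighbourhood of $0$. Let $\bar g=g-\int g\,d\mu_*$, $\chi(x)=\int_0^\infty P(t)\bar g(x)\,dt$, $M(1)=\chi(\Psi(1))-\chi(\Psi(0))+\int_0^1\bar g(\Psi(s))\,ds$ and $\sigma^2=\mathbb{E}_{\mu_*}(M(1)^2)$. Then $$\sigma^2=-2\int_E\chi\,\mathcal{A}\chi\,d\mu_*=2\int_E\chi\,\bar g\,d\mu_*,$$ where $\mathcal{A}$ is the infinitesimal generator defined in the context.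
   Context: $\mathcal{M}_1(E)$: Borel probability measures; $\operatorname{Lip}_b(E)$: bounded Lipschitz functions with $\|f\|_{\mathrm{BL}}=\max\{\|f\|_\infty,\sup_{x\neq y}|f(x)-f(y)|/\rho(x,y)\}$; $d_{\mathrm{FM}}(\mu,\nu)=\sup\{|\int f\,d\mu-\int f\,d\nu|:\|f\|_{\mathrm{BL}}\leq1\}$. $P(t)f(x)=\int f(y)P(t)(x,dy)$, $\nu P(t)=\int P(t)(x,\cdot)\nu(dx)$; $\mathbb{E}_{\mu_*}$ is expectation for the process with initial distribution $\mu_*$. Generator: let $\mathbb{L}$ be the space of Borel functions $f\in\mathcal{L}^2(\mu_* )$ such that $f^2$ is integrable with respect to $\delta_xP(t)$ for every $x\in E$ and $t\geq0$; let $\|f\|_2=(\int f^2\,d\mu_* )^{1/2}$; $\mathbb{L}_0=\{f\in\mathbb{L}:\lim_{t\to0^+}\|P(t)f-f\|_2=0\}$; $D_{\mathcal{A}}=\{f\in\mathbb{L}_0:\exists\hat f\in\mathbb{L}_0,\ \lim_{t\to0^+}\|(P(t)f-f)/t-\hat f\|_2=0\}$, and $\mathcal{A}f=\hat f$ (the $\|\cdot\|_2$-limit of $(P(t)f-f)/t$) for $f\in D_{\mathcal{A}}$. (In this setting $\chi\in D_{\mathcal{A}}$.) *)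

theory Defs
  imports "HOL-Probability.Probability"
begin

definition Pf :: "(real \<Rightarrow> 'a \<Rightarrow> 'a measure) \<Rightarrow> real \<Rightarrow> ('a \<Rightarrow> real) \<Rightarrow> 'a \<Rightarrow> real" where
  "Pf P t f x = (\<integral>y. f y \<partial>(P t x))"

definition BL1 :: "('a::metric_space \<Rightarrow> real) \<Rightarrow> bool" where
  "BL1 f \<longleftrightarrow> (\<forall>x. \<bar>f x\<bar> \<le> 1) \<and> (\<forall>x y. \<bar>f x - f y\<bar> \<le> dist x y)"

definition dFM :: "'a::metric_space measure \<Rightarrow> 'a measure \<Rightarrow> real" where
  "dFM \<mu> \<nu> = (SUP f\<in>{f. BL1 f}. \<bar>(\<integral>x. f x \<partial>\<mu>) - (\<integral>x. f x \<partial>\<nu>)\<bar>)"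

definition norm2 :: "'a measure \<Rightarrow> ('a \<Rightarrow> real) \<Rightarrow> real" where
  "norm2 \<mu> f = sqrt (\<integral>x. (f x)\<^sup>2 \<partial>\<mu>)"

definition Lspace :: "(real \<Rightarrow> 'a \<Rightarrow> 'a measure) \<Rightarrow> 'a::topological_space measure \<Rightarrow> ('a \<Rightarrow> real) set" where
  "Lspace P \<mu> = {f. f \<in> borel_measurable borel \<and> integrable \<mu> (\<lambda>x. (f x)\<^sup>2) \<and>
       (\<forall>x. \<forall>t\<ge>0. integrable (P t x) (\<lambda>y. (f y)\<^sup>2))}"

definition L0space :: "(real \<Rightarrow> 'a \<Rightarrow> 'a measure) \<Rightarrow> 'a::topological_space measure \<Rightarrow> ('a \<Rightarrow> real) set" where
  "L0space P \<mu> = {f \<in> Lspace P \<mu>.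
       ((\<lambda>t. norm2 \<mu> (\<lambda>x. Pf P t f x - f x)) \<longlongrightarrow> 0) (at_right 0)}"

definition gen_limit :: "(real \<Rightarrow> 'a \<Rightarrow> 'a measure) \<Rightarrow> 'a::topological_space measure \<Rightarrow> ('a \<Rightarrow> real) \<Rightarrow> ('a \<Rightarrow> real) \<Rightarrow> bool" where
  "gen_limit P \<mu> f h \<longleftrightarrow> h \<in> L0space P \<mu> \<and>
       ((\<lambda>t. norm2 \<mu> (\<lambda>x. (Pf P t f x - f x) / t - h x)) \<longlongrightarrow> 0) (at_right 0)"

definition gen_dom :: "(real \<Rightarrow> 'a \<Rightarrow> 'a measure) \<Rightarrow> 'a::topological_space measure \<Rightarrow> ('a \<Rightarrow> real) set" where
  "gen_dom P \<mu> = {f \<in> L0space P \<mu>. \<exists>h. gen_limit P \<mu> f h}"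

text \<open>The generator (a chosen representative of the L2-limit; unique mu-a.e.)\<close>
definition generator :: "(real \<Rightarrow> 'a \<Rightarrow> 'a measure) \<Rightarrow> 'a::topological_space measure \<Rightarrow> ('a \<Rightarrow> real) \<Rightarrow> ('a \<Rightarrow> real)" where
  "generator P \<mu> f = (SOME h. gen_limit P \<mu> f h)"

definition nat_filt :: "'w measure \<Rightarrow> (real \<Rightarrow> 'w \<Rightarrow> 'a::topological_space) \<Rightarrow> real \<Rightarrow> 'w measure" where
  "nat_filt M X s = sigma (space M) {X r -` B \<inter> space M | r B. 0 \<le> r \<and> r \<le> s \<and> B \<in> sets borel}"

end

theory Submission
  imports Defs
begin

text \<open>
Write \<open>f = gbar\<close> and \<open>\<langle>u, v\<rangle> = \<integral> u v d\<mu>\<close>. The decay of \<open>P t f\<close> makes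
\<open>chi = \<integral>\<^sub>0\<^sup>\<infinity> P t f dt\<close> converge, and \<open>chi - P t chi = \<integral>\<^sub>0\<^sup>t P s f ds\<close>, so \<open>-f\<close> is the generator
of \<open>chi\<close>; square integrability comes from \<open>\<integral> V\<^sup>2 d\<mu> \<le> B\<close>, which follows from invariance and the
Lyapunov bound applied to the truncations of \<open>V\<^sup>2\<close>.

The variance is then a covariance computation that needs no martingale theory. Put
\<open>Z = \<integral>\<^sub>0\<^sup>1 f(X s) ds\<close>. Stationarity and the Markov property give
\<open>E[u(X s) \<integral>\<^sub>s\<^sup>1 f(X t) dt] = \<langle>u, chi - P (1 - s) chi\<rangle>\<close>. Writing \<open>Z\<^sup>2\<close> as twice the integral over
\<open>s \<le> t\<close> yields \<open>E[Z\<^sup>2] = 2 \<langle>f, chi\<rangle> - 2 J\<close> with \<open>J = \<integral>\<^sub>0\<^sup>1 \<langle>f, P (1 - s) chi\<rangle> ds = E[chi(X 1) Z]\<close>,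
while \<open>E[(chi(X 1) - chi(X 0))\<^sup>2] = 2 \<langle>chi, chi - P 1 chi\<rangle> = 2 E[chi(X 0) Z]\<close>. In the
expansion of the square everything cancels except \<open>2 \<langle>f, chi\<rangle>\<close>.
\<close>

section \<open>Kernels, time averages and the bounded Lipschitz metric\<close>

text \<open>For \<open>nn_integral\<close> this is Tonelli's theorem for \<open>bind\<close>.
  Finiteness of the total makes the inner integral finite almost everywhere, and there it agrees
  with the Bochner integral; on the remaining null set the latter has the default value 0, which
  changes nothing.\<close>

lemma nonneg_integral_bind_kernel:
  fixes f :: "'b \<Rightarrow> real"
  assumes N: "N \<in> M \<rightarrow>\<^sub>M subprob_algebra K"
    and f [measurable]: "f \<in> borel_measurable K" and nonneg: "\<And>y. 0 \<le> f y"
    and fin: "(\<integral>\<^sup>+y. f y \<partial>(M \<bind> N)) < \<infinity>"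
  shows "AE x in M. integrable (N x) f"
    and "integrable M (\<lambda>x. \<integral>y. f y \<partial>N x)"
    and "(\<integral>x. \<integral>y. f y \<partial>N x \<partial>M) = (\<integral>y. f y \<partial>(M \<bind> N))"
proof -
  have [measurable]: "(\<lambda>x. \<integral>\<^sup>+y. f y \<partial>N x) \<in> borel_measurable M"
    by (rule measurable_compose[OF N]) measurable
  have [measurable]: "(\<lambda>x. \<integral>y. f y \<partial>N x) \<in> borel_measurable M"
    by (rule measurable_compose[OF N]) measurable
  have eq: "(\<integral>\<^sup>+y. f y \<partial>(M \<bind> N)) = (\<integral>\<^sup>+x. \<integral>\<^sup>+y. f y \<partial>N x \<partial>M)"
    by (rule nn_integral_bind[OF _ N]) simp
  have "AE x in M. (\<integral>\<^sup>+y. f y \<partial>N x) \<noteq> \<infinity>"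
    using fin eq by (intro nn_integral_PInf_AE) auto
  then show ae: "AE x in M. integrable (N x) f"
    using AE_space
  proof eventually_elim
    case (elim x)
    then have "f \<in> borel_measurable (N x)"
      using subprob_measurableD(2)[OF N] by (simp cong: measurable_cong_sets)
    then show ?case
      using elim nonneg by (simp add: integrable_iff_bounded less_top)
  qed
  then have "AE x in M. (\<integral>\<^sup>+y. f y \<partial>N x) = ennreal (\<integral>y. f y \<partial>N x)"
    by eventually_elim (simp add: nn_integral_eq_integral nonneg)
  then have eq2: "(\<integral>\<^sup>+x. \<integral>\<^sup>+y. f y \<partial>N x \<partial>M) = (\<integral>\<^sup>+x. ennreal (\<integral>y. f y \<partial>N x) \<partial>M)"
    by (rule nn_integral_cong_AE)
  show int: "integrable M (\<lambda>x. \<integral>y. f y \<partial>N x)"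
    using fin eq eq2 nonneg by (intro integrableI_nonneg) (auto intro!: Bochner_Integration.integral_nonneg)
  show "(\<integral>x. \<integral>y. f y \<partial>N x \<partial>M) = (\<integral>y. f y \<partial>(M \<bind> N))"
  \<comment> \<open>Over an empty space \<open>bind\<close> yields \<open>count_space {}\<close>, so
    its sets need not be those of \<open>K\<close>; both integrals are then 0.\<close>
  proof (cases "space M = {}")
    case True
    have "M \<bind> N = count_space {}"
      by (rule bind_empty[OF True])
    then show ?thesis
      using True by (simp add: Bochner_Integration.integral_empty)
  next
    case False
    then have "f \<in> borel_measurable (M \<bind> N)"
      using sets_bind[OF subprob_measurableD(2)[OF N] False] by (simp cong: measurable_cong_sets)
    then show ?thesis
      using eq eq2 nonneg
      by (simp add: integral_eq_nn_integral Bochner_Integration.integral_nonneg)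
  qed
qed

text \<open>Fubini for a kernel: the nonnegative case is applied to the positive and the negative
  part of \<open>f\<close>. The inner integral splits only where both parts are integrable, hence
  the almost-everywhere equality \<open>ae\<close>.\<close>

lemma
  fixes f :: "'b \<Rightarrow> real"
  assumes N: "N \<in> M \<rightarrow>\<^sub>M subprob_algebra K"
    and f [measurable]: "f \<in> borel_measurable K"
    and int: "integrable (M \<bind> N) f"
  shows integrable_bind_kernel: "integrable M (\<lambda>x. \<integral>y. f y \<partial>N x)"
    and integral_bind_kernel: "(\<integral>x. \<integral>y. f y \<partial>N x \<partial>M) = (\<integral>y. f y \<partial>(M \<bind> N))"
proof -
  let ?p = "\<lambda>y. max 0 (f y)" and ?m = "\<lambda>y. max 0 (- f y)"
  have ip: "integrable (M \<bind> N) ?p" and im: "integrable (M \<bind> N) ?m"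
    using int by auto
  have fp: "(\<integral>\<^sup>+y. ?p y \<partial>(M \<bind> N)) < \<infinity>" and fm: "(\<integral>\<^sup>+y. ?m y \<partial>(M \<bind> N)) < \<infinity>"
    using ip im by (auto simp: integrable_iff_bounded)
  note p = nonneg_integral_bind_kernel[OF N _ _ fp, simplified]
  note m = nonneg_integral_bind_kernel[OF N _ _ fm, simplified]
  have f_eq: "f = (\<lambda>y. ?p y - ?m y)"
    by (auto simp: max_def)
  have ae: "AE x in M. (\<integral>y. ?p y \<partial>N x) - (\<integral>y. ?m y \<partial>N x) = (\<integral>y. f y \<partial>N x)"
    using p(1) m(1)
  proof eventually_elim
    case (elim x)
    then show ?case
      by (subst (3) f_eq) auto
  qed
  have [measurable]: "(\<lambda>x. \<integral>y. h y \<partial>N x) \<in> borel_measurable M" if [measurable]: "h \<in> borel_measurable K" for h :: "'b \<Rightarrow> real"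
    by (rule measurable_compose[OF N]) measurable
  have "integrable M (\<lambda>x. (\<integral>y. ?p y \<partial>N x) - (\<integral>y. ?m y \<partial>N x))"
    using p(2) m(2) by simp
  then show "integrable M (\<lambda>x. \<integral>y. f y \<partial>N x)"
    by (rule integrable_cong_AE_imp[OF _ _ ae]) measurable
  have "(\<integral>x. \<integral>y. f y \<partial>N x \<partial>M) = (\<integral>x. (\<integral>y. ?p y \<partial>N x) - (\<integral>y. ?m y \<partial>N x) \<partial>M)"
    using ae by (intro integral_cong_AE) auto
  also have "\<dots> = (\<integral>y. ?p y \<partial>(M \<bind> N)) - (\<integral>y. ?m y \<partial>(M \<bind> N))"
    using p m by simp
  also have "\<dots> = (\<integral>y. f y \<partial>(M \<bind> N))"
    by (subst (3) f_eq) (use ip im in simp)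
  finally show "(\<integral>x. \<integral>y. f y \<partial>N x \<partial>M) = (\<integral>y. f y \<partial>(M \<bind> N))" .
qed

section \<open>Joint measurability, Fubini and averages in time\<close>

text \<open>Each time is replaced by the next point of a grid of mesh \<open>1 / Suc n\<close>. The
  approximants read only countably many of the functions \<open>q t\<close>, so they are jointly
  measurable, and right continuity makes them converge to \<open>q\<close>.\<close>

lemma borel_measurable_right_continuous:
  fixes q :: "real \<Rightarrow> 'b \<Rightarrow> real"
  assumes meas: "\<And>t. q t \<in> borel_measurable N"
    and rc: "\<And>t x. x \<in> space N \<Longrightarrow> ((\<lambda>s. q s x) \<longlongrightarrow> q t x) (at_right t)"
  shows "(\<lambda>(t, x). q t x) \<in> borel_measurable (borel \<Otimes>\<^sub>M N)"
proof (rule borel_measurable_LIMSEQ_real)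
  \<comment> \<open>The summand 1 puts \<open>d n t\<close> strictly to the right of
    \<open>t\<close>, as the filter \<open>at_right t\<close> demands.\<close>
  define d where "d n t = (of_int \<lfloor>t * Suc n\<rfloor> + 1) / real (Suc n)" for n :: nat and t :: real
  have d: "t < d n t" "d n t \<le> t + 1 / Suc n" for n t
    unfolding d_def by (simp_all add: field_simps del: of_nat_Suc) linarith+
  show "(\<lambda>n. q (d n (fst z)) (snd z)) \<longlonglongrightarrow> (case z of (t, x) \<Rightarrow> q t x)"
    if "z \<in> space (borel \<Otimes>\<^sub>M N)" for z
  proof -
    obtain t x where z: "z = (t, x)" by force
    have x: "x \<in> space N"
      using that z by (simp add: space_pair_measure)
    have "(\<lambda>n. d n t) \<longlonglongrightarrow> t"
    proof (rule tendsto_sandwich[OF _ _ tendsto_const])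
      show "(\<lambda>n. t + 1 / Suc n) \<longlonglongrightarrow> t"
        using tendsto_add[OF tendsto_const LIMSEQ_inverse_real_of_nat, of t]
        by (simp add: inverse_eq_divide)
    qed (use d less_imp_le[OF d(1)] in auto)
    then have "filterlim (\<lambda>n. d n t) (at_right t) sequentially"
      by (rule tendsto_imp_filterlim_at_right) (use d(1) in simp)
    then show ?thesis
      using filterlim_compose[OF rc[OF x]] z by simp
  qed
  show "(\<lambda>z. q (d n (fst z)) (snd z)) \<in> borel_measurable (borel \<Otimes>\<^sub>M N)" for n
    unfolding d_def
  proof (rule measurable_compose_countable[where f = "\<lambda>k z. q ((of_int k + 1) / real (Suc n)) (snd z)"
        and g = "\<lambda>z. \<lfloor>fst z * real (Suc n)\<rfloor>"])
    show "(\<lambda>z. q ((of_int k + 1) / real (Suc n)) (snd z)) \<in> borel_measurable (borel \<Otimes>\<^sub>M N)" for k :: int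
      by (rule measurable_compose[OF measurable_snd meas])
  qed measurable
qed

text \<open>The square is the integral of \<open>h s * h t\<close> over the plane. Fubini carries
  the half \<open>s \<le> t\<close> to the other order of integration; there, completing the
  half-line gives the whole square minus the half \<open>s \<ge> t\<close>, which is the same number
  after renaming.\<close>

lemma square_lborel_integral:
  fixes h :: "real \<Rightarrow> real"
  assumes h: "integrable lborel h"
  shows "(\<integral>s. h s \<partial>lborel)\<^sup>2 = 2 * (\<integral>s. h s * (\<integral>t. indicator {s..} t * h t \<partial>lborel) \<partial>lborel)"
proof -
  have [measurable]: "h \<in> borel_measurable borel"
    using h by auto
  have hi: "integrable lborel (\<lambda>t. indicator S t * h t)" if "S \<in> sets borel" for S
    using integrable_mult_indicator[OF _ h, of S] that by simp
  let ?F = "\<lambda>(s, t). h s * (indicator {..t} s * h t)"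
  have F: "integrable (lborel \<Otimes>\<^sub>M lborel) ?F"
  proof (rule lborel_pair.Fubini_integrable)
    show "?F \<in> borel_measurable (lborel \<Otimes>\<^sub>M lborel)"
    proof -
      \<comment> \<open>The indicator of a set that moves with \<open>t\<close> hides its joint
        measurability; the order relation \<open>s \<le> t\<close> exposes it.\<close>
      have "?F = (\<lambda>(s, t). h s * ((if s \<le> t then 1 else 0) * h t))"
        by (auto simp: fun_eq_iff)
      also have "\<dots> \<in> borel_measurable (lborel \<Otimes>\<^sub>M lborel)"
        by measurable
      finally show ?thesis .
    qed
    have eq: "(case (s, t) of (s, t) \<Rightarrow> h s * (indicator {..t} s * h t)) = h s * (indicator {s..} t * h t)" for s t
      by (auto simp: indicator_def)
    show "AE s in lborel. integrable lborel (\<lambda>t. ?F (s, t))"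
      unfolding eq using hi by auto
    have "integrable lborel (\<lambda>s. \<bar>h s\<bar> * (\<integral>t. \<bar>h t\<bar> \<partial>lborel))"
      using h by auto
    then show "integrable lborel (\<lambda>s. \<integral>t. norm (?F (s, t)) \<partial>lborel)"
    proof (rule Bochner_Integration.integrable_bound)
      show "AE s in lborel. norm (\<integral>t. norm (?F (s, t)) \<partial>lborel) \<le> norm (\<bar>h s\<bar> * (\<integral>t. \<bar>h t\<bar> \<partial>lborel))"
      proof (rule AE_I2)
        fix s
        have "(\<integral>t. norm (?F (s, t)) \<partial>lborel) = \<bar>h s\<bar> * (\<integral>t. \<bar>indicator {s..} t * h t\<bar> \<partial>lborel)"
          unfolding eq by (simp add: abs_mult)
        also have "\<dots> \<le> \<bar>h s\<bar> * (\<integral>t. \<bar>h t\<bar> \<partial>lborel)"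
          using h hi[of "{s..}"] by (intro mult_left_mono integral_mono) (auto simp: indicator_def)
        finally show "norm (\<integral>t. norm (?F (s, t)) \<partial>lborel) \<le> norm (\<bar>h s\<bar> * (\<integral>t. \<bar>h t\<bar> \<partial>lborel))"
          by simp
      qed
      have "(\<lambda>s. \<integral>t. norm (h s * ((if s \<le> t then 1 else 0) * h t)) \<partial>lborel) \<in> borel_measurable lborel"
        by measurable
      then show "(\<lambda>s. \<integral>t. norm (?F (s, t)) \<partial>lborel) \<in> borel_measurable lborel"
        by (rule measurable_cong[THEN iffD1, rotated]) (auto simp: indicator_def intro!: Bochner_Integration.integral_cong)
    qed
  qed
  have upper: "(\<integral>s. \<integral>t. ?F (s, t) \<partial>lborel \<partial>lborel) = (\<integral>s. h s * (\<integral>t. indicator {s..} t * h t \<partial>lborel) \<partial>lborel)"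
    by (auto simp: indicator_def intro!: Bochner_Integration.integral_cong simp flip: integral_mult_right_zero)
  have "(\<integral>s. \<integral>t. ?F (s, t) \<partial>lborel \<partial>lborel) = (\<integral>t. \<integral>s. ?F (s, t) \<partial>lborel \<partial>lborel)"
    using lborel_pair.Fubini_integral[of "\<lambda>s t. ?F (s, t)"] F by simp
  also have "\<dots> = (\<integral>t. h t * (\<integral>s. indicator {..t} s * h s \<partial>lborel) \<partial>lborel)"
    by (auto simp: ac_simps intro!: Bochner_Integration.integral_cong simp flip: integral_mult_right_zero)
  also have "\<dots> = (\<integral>t. h t * (\<integral>s. h s \<partial>lborel) - h t * (\<integral>s. indicator {t..} s * h s \<partial>lborel) \<partial>lborel)"
  proof (rule Bochner_Integration.integral_cong[OF refl])
    fix t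
    \<comment> \<open>The two half-lines overlap in the point \<open>t\<close>, a null set.\<close>
    have "(\<integral>s. indicator {..t} s * h s \<partial>lborel) = (\<integral>s. h s - indicator {t..} s * h s \<partial>lborel)"
      by (rule integral_cong_AE) (use AE_lborel_singleton[of t] in \<open>auto simp: indicator_def elim: eventually_mono\<close>)
    also have "\<dots> = (\<integral>s. h s \<partial>lborel) - (\<integral>s. indicator {t..} s * h s \<partial>lborel)"
      using h hi by auto
    finally show "h t * (\<integral>s. indicator {..t} s * h s \<partial>lborel) =
        h t * (\<integral>s. h s \<partial>lborel) - h t * (\<integral>s. indicator {t..} s * h s \<partial>lborel)"
      by (simp add: right_diff_distrib)
  qed
  also have "\<dots> = (\<integral>s. h s \<partial>lborel)\<^sup>2 - (\<integral>s. h s * (\<integral>t. indicator {s..} t * h t \<partial>lborel) \<partial>lborel)"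
  proof (subst Bochner_Integration.integral_diff)
    have "integrable lborel (\<lambda>s. \<integral>t. ?F (s, t) \<partial>lborel)"
      using lborel_pair.integrable_fst'[OF F] .
    then show "integrable lborel (\<lambda>s. h s * (\<integral>t. indicator {s..} t * h t \<partial>lborel))"
      by (auto simp: indicator_def elim!: integrable_cong[THEN iffD1, rotated -1]
          intro!: Bochner_Integration.integral_cong simp flip: integral_mult_right_zero)
  qed (use h in \<open>auto simp: power2_eq_square\<close>)
  finally show ?thesis
    using upper by simp
qed

lemma lborel_shift: "(\<integral>s. h (t + s) \<partial>lborel) = (\<integral>s. h s \<partial>lborel)" for h :: "real \<Rightarrow> real"
  using lborel_integral_real_affine[of 1 h t] by simp

text \<open>For times in \<open>{a..b}\<close> the product is dominated by
  \<open>\<bar>u y\<bar> * K\<close>, whose integral over \<open>{a..b}\<close> and \<open>N\<close>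
  is finite, so Fubini applies although \<open>u\<close> may be unbounded. It serves for sample
  paths (\<open>N = M\<close>) and for the semigroup (\<open>N = \<mu>\<close>).\<close>

lemma Fubini_time_average:
  fixes u :: "'b \<Rightarrow> real" and h :: "real \<Rightarrow> 'b \<Rightarrow> real"
  assumes N: "sigma_finite_measure N" and u: "integrable N u"
    and h [measurable]: "(\<lambda>(t, y). h t y) \<in> borel_measurable (lborel \<Otimes>\<^sub>M N)"
    and bound: "\<And>t y. \<bar>h t y\<bar> \<le> K"
  shows "integrable N (\<lambda>y. u y * (\<integral>t. indicator {a..b} t * h t y \<partial>lborel))" (is ?int1)
    and "integrable lborel (\<lambda>t. indicator {a..b} t * (\<integral>y. u y * h t y \<partial>N))" (is ?int2)
    and "(\<integral>y. u y * (\<integral>t. indicator {a..b} t * h t y \<partial>lborel) \<partial>N) =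
      (\<integral>t. indicator {a..b} t * (\<integral>y. u y * h t y \<partial>N) \<partial>lborel)" (is ?eq)
proof -
  interpret N: sigma_finite_measure N by (rule N)
  interpret pair_sigma_finite lborel N ..
  let ?F = "\<lambda>t y. indicator {a..b} t * (u y * h t y)"
  have [measurable]: "u \<in> borel_measurable N"
    using u by simp
  have hm: "h t \<in> borel_measurable N" for t
    using measurable_compose[OF measurable_Pair1'[of t lborel N] h] by simp
  have uh: "integrable N (\<lambda>y. u y * h t y)" for t
    using bound by (intro Bochner_Integration.integrable_bound[OF integrable_mult_left[OF u, of K]])
      (auto simp: abs_mult hm intro!: mult_left_mono order_trans[OF bound abs_ge_self] borel_measurable_times)
  have F: "integrable (lborel \<Otimes>\<^sub>M N) (\<lambda>(t, y). ?F t y)"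
  proof (rule Fubini_integrable)
    show "integrable lborel (\<lambda>t. \<integral>y. norm (case (t, y) of (t, y) \<Rightarrow> ?F t y) \<partial>N)"
    proof (rule Bochner_Integration.integrable_bound)
      show "integrable lborel (\<lambda>t. indicator {a..b} t * (\<integral>y. \<bar>u y\<bar> * K \<partial>N))"
        by (intro integrable_mult_left integrable_real_indicator) (auto simp: emeasure_lborel_Icc_eq)
      show "AE t in lborel. norm (\<integral>y. norm (case (t, y) of (t, y) \<Rightarrow> ?F t y) \<partial>N)
          \<le> norm (indicator {a..b} t * (\<integral>y. \<bar>u y\<bar> * K \<partial>N))"
      proof (rule AE_I2)
        fix t :: real
        have "(\<integral>y. \<bar>?F t y\<bar> \<partial>N) = indicator {a..b} t * (\<integral>y. \<bar>u y * h t y\<bar> \<partial>N)"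
          by (simp add: abs_mult)
        also have "\<dots> \<le> indicator {a..b} t * (\<integral>y. \<bar>u y\<bar> * K \<partial>N)"
          using u integrable_abs[OF uh[of t]] bound
          by (intro mult_left_mono integral_mono) (auto simp: abs_mult intro!: mult_left_mono)
        finally show "norm (\<integral>y. norm (case (t, y) of (t, y) \<Rightarrow> ?F t y) \<partial>N)
            \<le> norm (indicator {a..b} t * (\<integral>y. \<bar>u y\<bar> * K \<partial>N))"
          by simp
      qed
    qed measurable
    show "AE t in lborel. integrable N (\<lambda>y. case (t, y) of (t, y) \<Rightarrow> ?F t y)"
      using uh by simp
  qed measurable
  have inner: "(\<integral>t. ?F t y \<partial>lborel) = u y * (\<integral>t. indicator {a..b} t * h t y \<partial>lborel)" for y
    by (simp add: mult.left_commute flip: integral_mult_right_zero)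
  show ?int1
    using integrable_snd[OF F] by (simp add: inner)
  show ?int2
    using integrable_fst[OF F] by simp
  show ?eq
    using Fubini_integral[OF F] by (simp add: inner)
qed

text \<open>The right derivative at 0 of an indefinite integral. Near 0 the integrand is within
  \<open>\<epsilon> / 2\<close> of \<open>L\<close>, and averaging preserves this bound.\<close>

lemma average_tendsto_at_right_0:
  fixes h :: "real \<Rightarrow> real"
  assumes h: "integrable lborel h" and lim: "(h \<longlongrightarrow> L) (at_right 0)"
  shows "((\<lambda>t. (\<integral>s. indicator {0..t} s * h s \<partial>lborel) / t) \<longlongrightarrow> L) (at_right 0)"
proof (rule tendstoI)
  fix \<epsilon> :: real assume \<epsilon>: "\<epsilon> > 0"
  have "eventually (\<lambda>t. dist (h t) L < \<epsilon> / 2) (at_right 0)"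
    using tendstoD[OF lim, of "\<epsilon> / 2"] \<epsilon> by simp
  then obtain d where d: "d > 0" "\<And>s. 0 < s \<Longrightarrow> s < d \<Longrightarrow> \<bar>h s - L\<bar> < \<epsilon> / 2"
    by (auto simp: eventually_at_right_field dist_real_def)
  have "\<bar>(\<integral>s. indicator {0..t} s * h s \<partial>lborel) / t - L\<bar> < \<epsilon>" if t: "0 < t" "t < d" for t
  proof -
    have ih: "integrable lborel (\<lambda>s. indicator {0..t} s * h s)"
      using integrable_mult_indicator[OF _ h, of "{0..t}"] by simp
    have ic: "integrable lborel (\<lambda>s. indicator {0..t} s * c)" for c :: real
      using t by (intro integrable_mult_left integrable_real_indicator) auto
    have "(\<integral>s. indicator {0..t} s * h s \<partial>lborel) - t * L = (\<integral>s. indicator {0..t} s * h s - indicator {0..t} s * L \<partial>lborel)"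
      using t by (simp add: Bochner_Integration.integral_diff[OF ih ic])
    also have "\<bar>\<dots>\<bar> \<le> (\<integral>s. \<bar>indicator {0..t} s * h s - indicator {0..t} s * L\<bar> \<partial>lborel)"
      by (rule integral_abs_bound)
    also have "\<dots> \<le> (\<integral>s. indicator {0..t} s * (\<epsilon> / 2) \<partial>lborel)"
    proof (rule integral_mono_AE)
      \<comment> \<open>A right limit says nothing about \<open>h 0\<close>, so the null set
        \<open>{0}\<close> is discarded.\<close>
      show "AE s in lborel. \<bar>indicator {0..t} s * h s - indicator {0..t} s * L\<bar> \<le> indicator {0..t} s * (\<epsilon> / 2)"
        using AE_lborel_singleton[of 0]
      proof eventually_elim
        case (elim s)
        then show ?case
          using d(2)[of s] t by (auto simp: indicator_def)
      qed
    qed (use ih ic in auto)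
    also have "\<dots> = t * (\<epsilon> / 2)"
      using t by simp
    also have "\<dots> < t * \<epsilon>"
      using t \<epsilon> by simp
    finally have "\<bar>(\<integral>s. indicator {0..t} s * h s \<partial>lborel) - t * L\<bar> / t < \<epsilon>"
      using t by (simp add: pos_divide_less_eq mult.commute)
    moreover have "(\<integral>s. indicator {0..t} s * h s \<partial>lborel) / t - L = ((\<integral>s. indicator {0..t} s * h s \<partial>lborel) - t * L) / t"
      using t by (simp add: diff_divide_distrib)
    ultimately show ?thesis
      using t by simp
  qed
  then show "eventually (\<lambda>t. dist ((\<integral>s. indicator {0..t} s * h s \<partial>lborel) / t) L < \<epsilon>) (at_right 0)"
    using d(1) by (auto simp: eventually_at_right_field dist_real_def)
qed

lemma integrable_square_diff:
  fixes u v :: "'b \<Rightarrow> real"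
  assumes [measurable]: "u \<in> borel_measurable N" "v \<in> borel_measurable N"
    and "integrable N (\<lambda>x. (u x)\<^sup>2)" "integrable N (\<lambda>x. (v x)\<^sup>2)"
  shows "integrable N (\<lambda>x. (u x - v x)\<^sup>2)"
proof (rule Bochner_Integration.integrable_bound)
  show "integrable N (\<lambda>x. 2 * (u x)\<^sup>2 + 2 * (v x)\<^sup>2)"
    using assms by auto
  have "(u x - v x)\<^sup>2 \<le> 2 * (u x)\<^sup>2 + 2 * (v x)\<^sup>2" for x
    using zero_le_power2[of "u x + v x"] by (simp add: power2_diff power2_sum)
  then show "AE x in N. norm ((u x - v x)\<^sup>2) \<le> norm (2 * (u x)\<^sup>2 + 2 * (v x)\<^sup>2)"
    by auto
qed measurable

section \<open>Test functions of the bounded Lipschitz metric\<close>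

text \<open>Integrability of \<open>f\<close> is not assumed: otherwise the integral has the default
  value 0. The supremum in \<open>dFM\<close> thus stays bounded for arbitrary probability
  measures.\<close>

lemma abs_integral_le_1:
  fixes f :: "'b \<Rightarrow> real"
  assumes "prob_space N" and "\<And>x. \<bar>f x\<bar> \<le> 1"
  shows "\<bar>\<integral>x. f x \<partial>N\<bar> \<le> 1"
proof (cases "integrable N f")
  case True
  interpret prob_space N by fact
  have "\<bar>\<integral>x. f x \<partial>N\<bar> \<le> (\<integral>x. \<bar>f x\<bar> \<partial>N)"
    by (rule integral_abs_bound)
  also have "\<dots> \<le> (\<integral>x. 1 \<partial>N)"
    using True assms(2) by (intro integral_mono) auto
  finally show ?thesis
    by (simp add: prob_space)
qed (simp add: not_integrable_integral_eq)

text \<open>A real supremum dominates its members once the set is bounded above; the bound 2 comes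
  from two integrals of absolute value at most 1.\<close>

lemma BL1_integral_diff_le_dFM:
  assumes "prob_space \<nu>" "prob_space \<mu>" and f: "BL1 f"
  shows "\<bar>(\<integral>x. f x \<partial>\<nu>) - (\<integral>x. f x \<partial>\<mu>)\<bar> \<le> dFM \<nu> \<mu>"
  unfolding dFM_def
proof (rule cSUP_upper)
  show "bdd_above ((\<lambda>f. \<bar>(\<integral>x. f x \<partial>\<nu>) - (\<integral>x. f x \<partial>\<mu>)\<bar>) ` {f. BL1 f})"
  proof (rule bdd_aboveI2[where M = 2])
    fix f :: "'a \<Rightarrow> real" assume "f \<in> {f. BL1 f}"
    then have "\<bar>\<integral>x. f x \<partial>\<nu>\<bar> \<le> 1" "\<bar>\<integral>x. f x \<partial>\<mu>\<bar> \<le> 1"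
      using assms(1,2) by (auto simp: BL1_def intro!: abs_integral_le_1)
    then show "\<bar>(\<integral>x. f x \<partial>\<nu>) - (\<integral>x. f x \<partial>\<mu>)\<bar> \<le> 2"
      by linarith
  qed
qed (use f in simp)

lemma ex_BL1_scaling:
  fixes g :: "'a::metric_space \<Rightarrow> real"
  assumes bdd: "bounded (range g)" and lip: "L-lipschitz_on UNIV g"
  obtains c where "c > 0" and "\<And>x. \<bar>g x\<bar> \<le> c" and "BL1 (\<lambda>x. g x / c)"
proof -
  obtain b where b: "\<And>x. \<bar>g x\<bar> \<le> b"
    using bdd by (auto simp: bounded_iff)
  \<comment> \<open>One constant exceeds both the sup bound and the Lipschitz constant; the summand
    1 keeps it positive when both are 0.\<close>
  define c where "c = max b L + 1"
  have L: "0 \<le> L"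
    using lipschitz_on_nonneg[OF lip] .
  have c: "c > 0" "b \<le> c" "L \<le> c"
    using L by (auto simp: c_def)
  have "\<bar>g x\<bar> \<le> c" for x
    using b[of x] c by linarith
  moreover have "BL1 (\<lambda>x. g x / c)"
    unfolding BL1_def
  proof (intro conjI allI)
    fix x y
    show "\<bar>g x / c\<bar> \<le> 1"
      using \<open>\<bar>g x\<bar> \<le> c\<close> c by simp
    have "\<bar>g x - g y\<bar> \<le> L * dist x y"
      using lipschitz_onD[OF lip, of x y] by (simp add: dist_real_def)
    also have "\<dots> \<le> c * dist x y"
      using c by (intro mult_right_mono) auto
    finally have "\<bar>g x - g y\<bar> / c \<le> dist x y"
      using c by (simp add: pos_divide_le_eq mult.commute)
    then show "\<bar>g x / c - g y / c\<bar> \<le> dist x y"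
      using c by (simp add: diff_divide_distrib[symmetric])
  qed
  ultimately show thesis
    using that c by blast
qed

section \<open>Markov semigroups and the corrector\<close>

locale invariant_markov_semigroup =
  fixes P :: "real \<Rightarrow> 'a::polish_space \<Rightarrow> 'a measure" and \<mu> :: "'a measure"
  assumes kernel: "\<And>t. t \<ge> 0 \<Longrightarrow> P t \<in> borel \<rightarrow>\<^sub>M prob_algebra borel"
    and P0: "\<And>x. P 0 x = return borel x"
    and semigroup: "\<And>s t x. s \<ge> 0 \<Longrightarrow> t \<ge> 0 \<Longrightarrow> P (s + t) x = P s x \<bind> P t"
    and mu_prob: "\<mu> \<in> space (prob_algebra borel)"
    and mu_inv: "\<And>t. t \<ge> 0 \<Longrightarrow> \<mu> \<bind> P t = \<mu>"
begin

lemma sets_mu [measurable_cong, simp]: "sets \<mu> = sets borel"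
  and space_mu [simp]: "space \<mu> = UNIV"
  using mu_prob by (auto simp: space_prob_algebra dest: sets_eq_imp_space_eq)

lemma prob_space_mu: "prob_space \<mu>"
  using mu_prob by (simp add: space_prob_algebra)

lemma prob_space_P: "t \<ge> 0 \<Longrightarrow> prob_space (P t x)"
  and sets_P: "t \<ge> 0 \<Longrightarrow> sets (P t x) = sets borel"
  using measurable_space[OF kernel, of t x] by (auto simp: space_prob_algebra)

lemma space_P: "t \<ge> 0 \<Longrightarrow> space (P t x) = UNIV"
  using sets_eq_imp_space_eq[OF sets_P] by simp

lemma measurable_P: "t \<ge> 0 \<Longrightarrow> f \<in> borel_measurable borel \<Longrightarrow> f \<in> borel_measurable (P t x)"
  using sets_P by (simp cong: measurable_cong_sets)

lemma subprob_kernel: "t \<ge> 0 \<Longrightarrow> P t \<in> borel \<rightarrow>\<^sub>M subprob_algebra borel"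
  by (rule measurable_prob_algebraD[OF kernel])

lemma subprob_kernel_mu: "t \<ge> 0 \<Longrightarrow> P t \<in> \<mu> \<rightarrow>\<^sub>M subprob_algebra borel"
  using subprob_kernel by (simp cong: measurable_cong_sets)

lemma subprob_kernel_P: "s \<ge> 0 \<Longrightarrow> t \<ge> 0 \<Longrightarrow> P t \<in> P s x \<rightarrow>\<^sub>M subprob_algebra borel"
  using subprob_kernel[of t] sets_P[of s x] by (simp cong: measurable_cong_sets)

lemma measurable_Pf [measurable (raw)]:
  "t \<ge> 0 \<Longrightarrow> f \<in> borel_measurable borel \<Longrightarrow> Pf P t f \<in> borel_measurable borel"
  unfolding Pf_def by (rule measurable_compose[OF subprob_kernel]) auto

lemma Pf_0: "f \<in> borel_measurable borel \<Longrightarrow> Pf P 0 f x = f x"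
  unfolding Pf_def P0 by (simp add: integral_return)

lemma integrable_P_bounded:
  fixes f :: "'a \<Rightarrow> real"
  assumes "t \<ge> 0" and "f \<in> borel_measurable borel" and "\<And>y. \<bar>f y\<bar> \<le> K"
  shows "integrable (P t x) f"
proof -
  interpret prob_space "P t x" by (rule prob_space_P[OF assms(1)])
  show ?thesis
    using assms by (intro integrable_const_bound[of _ K]) (auto simp: measurable_P)
qed

lemma Pf_abs_le:
  assumes "t \<ge> 0" and "f \<in> borel_measurable borel" and "\<And>y. \<bar>f y\<bar> \<le> K"
  shows "\<bar>Pf P t f x\<bar> \<le> K"
proof -
  interpret prob_space "P t x" by (rule prob_space_P[OF assms(1)])
  have "\<bar>Pf P t f x\<bar> \<le> (\<integral>y. \<bar>f y\<bar> \<partial>P t x)"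
    unfolding Pf_def by (rule integral_abs_bound)
  also have "\<dots> \<le> (\<integral>y. K \<partial>P t x)"
    using integrable_P_bounded[OF assms] assms(3) by (intro integral_mono) auto
  finally show ?thesis
    by (simp add: prob_space)
qed

lemma Pf_add:
  assumes "s \<ge> 0" "t \<ge> 0" and "f \<in> borel_measurable borel" and "integrable (P (s + t) x) f"
  shows "Pf P (s + t) f x = Pf P s (Pf P t f) x"
  using integral_bind_kernel[OF subprob_kernel_P[OF assms(1,2)] assms(3), of x] assms(4)
  by (simp add: Pf_def semigroup[OF assms(1,2)])

lemma integrable_Pf_mu:
  fixes f :: "'a \<Rightarrow> real"
  assumes "t \<ge> 0" and "f \<in> borel_measurable borel" and "integrable \<mu> f"
  shows "integrable \<mu> (Pf P t f)"
  using integrable_bind_kernel[OF subprob_kernel_mu[OF assms(1)] assms(2)] assms(3)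
  by (simp add: Pf_def[abs_def] mu_inv[OF assms(1)])

lemma nn_integral_P_mu:
  assumes "t \<ge> 0" and "f \<in> borel_measurable borel"
  shows "(\<integral>\<^sup>+x. \<integral>\<^sup>+y. f y \<partial>P t x \<partial>\<mu>) = (\<integral>\<^sup>+x. f x \<partial>\<mu>)"
  using nn_integral_bind[OF assms(2) subprob_kernel_mu[OF assms(1)]]
  by (simp add: mu_inv[OF assms(1)])

text \<open>Bounded convergence under the probability measure \<open>\<mu>\<close>, taken along
  sequences because dominated convergence is sequential. It turns pointwise limits into the L2
  limits in the definition of the generator.\<close>

lemma norm2_tendsto_0:
  fixes h :: "real \<Rightarrow> 'a \<Rightarrow> real"
  assumes meas: "\<And>t. t > 0 \<Longrightarrow> h t \<in> borel_measurable borel"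
    and bound: "\<And>t x. 0 < t \<Longrightarrow> t < 1 \<Longrightarrow> \<bar>h t x\<bar> \<le> K"
    and lim: "\<And>x. ((\<lambda>t. h t x) \<longlongrightarrow> 0) (at_right 0)"
  shows "((\<lambda>t. norm2 \<mu> (h t)) \<longlongrightarrow> 0) (at_right 0)"
proof (rule tendsto_at_right_sequentially[of _ 1])
  fix S :: "nat \<Rightarrow> real"
  assume S: "\<And>n. 0 < S n" "\<And>n. S n < 1" "S \<longlonglongrightarrow> 0"
  interpret prob_space \<mu> by (rule prob_space_mu)
  have "(\<lambda>n. \<integral>x. (h (S n) x)\<^sup>2 \<partial>\<mu>) \<longlonglongrightarrow> (\<integral>x. 0 \<partial>\<mu>)"
  proof (rule integral_dominated_convergence[where w = "\<lambda>_. K\<^sup>2"])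
    have "filterlim S (at_right 0) sequentially"
      by (rule tendsto_imp_filterlim_at_right) (use S in auto)
    from tendsto_power[OF filterlim_compose[OF lim this], of _ 2]
    show "AE x in \<mu>. (\<lambda>n. (h (S n) x)\<^sup>2) \<longlonglongrightarrow> 0"
      by simp
    show "AE x in \<mu>. norm ((h (S n) x)\<^sup>2) \<le> K\<^sup>2" for n
      using power_mono[OF bound[OF S(1)[of n] S(2)[of n]], of _ 2] by auto
  qed (use meas S(1) in auto)
  then show "(\<lambda>n. norm2 \<mu> (h (S n))) \<longlonglongrightarrow> 0"
    using tendsto_real_sqrt by (fastforce simp: norm2_def)
qed simp

text \<open>By invariance the integral of the truncation \<open>inf h n\<close> equals that of its
  image under \<open>P k\<close> for every \<open>k\<close>, hence also the limsup over
  \<open>k\<close>. The constant \<open>n\<close> is an integrable majorant, so reverse Fatou moves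
  the limsup inside, where \<open>c\<close> vanishes and \<open>B\<close> remains. Monotone
  convergence in \<open>n\<close> then removes the truncation.\<close>

lemma nn_integral_invariant_le:
  fixes h :: "'a \<Rightarrow> ennreal" and c :: "real \<Rightarrow> 'a \<Rightarrow> real"
  assumes [measurable]: "h \<in> borel_measurable borel"
    and le: "\<And>t x. t \<ge> 0 \<Longrightarrow> (\<integral>\<^sup>+y. h y \<partial>P t x) \<le> ennreal (c t x + B)"
    and c: "\<And>x. ((\<lambda>t. c t x) \<longlongrightarrow> 0) at_top"
  shows "(\<integral>\<^sup>+x. h x \<partial>\<mu>) \<le> ennreal B"
proof -
  interpret prob_space \<mu> by (rule prob_space_mu)
  have trunc: "(\<integral>\<^sup>+x. inf (h x) (of_nat n) \<partial>\<mu>) \<le> ennreal B" for n :: nat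
  proof -
    let ?u = "\<lambda>k x. \<integral>\<^sup>+y. inf (h y) (of_nat n) \<partial>P (real k) x"
    have "(\<integral>\<^sup>+x. inf (h x) (of_nat n) \<partial>\<mu>) = (\<integral>\<^sup>+x. ?u k x \<partial>\<mu>)" for k
      by (rule nn_integral_P_mu[symmetric]) auto
    then have "(\<integral>\<^sup>+x. inf (h x) (of_nat n) \<partial>\<mu>) = limsup (\<lambda>k. \<integral>\<^sup>+x. ?u k x \<partial>\<mu>)"
      by (simp add: Limsup_const)
    also have "\<dots> \<le> (\<integral>\<^sup>+x. limsup (\<lambda>k. ?u k x) \<partial>\<mu>)"
    proof (rule nn_integral_limsup[where w = "\<lambda>_. of_nat n"])
      show "?u k \<in> borel_measurable \<mu>" for k
        by (rule measurable_compose[OF subprob_kernel_mu]) auto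
      show "AE x in \<mu>. ?u k x \<le> of_nat n" for k
      proof (rule AE_I2)
        fix x
        interpret Px: prob_space "P (real k) x"
          by (rule prob_space_P) simp
        have "?u k x \<le> (\<integral>\<^sup>+y. of_nat n \<partial>P (real k) x)"
          by (rule nn_integral_mono) simp
        then show "?u k x \<le> of_nat n"
          by (simp add: Px.emeasure_space_1)
      qed
    qed (use emeasure_space_1 in \<open>auto simp: of_nat_less_top\<close>)
    also have "\<dots> \<le> (\<integral>\<^sup>+x. ennreal B \<partial>\<mu>)"
    proof (rule nn_integral_mono)
      fix x
      have "(\<lambda>k. ennreal (c (real k) x + B)) \<longlonglongrightarrow> ennreal (0 + B)"
        by (intro tendsto_ennrealI tendsto_add filterlim_compose[OF c filterlim_real_sequentially] tendsto_const)
      then have "limsup (\<lambda>k. ennreal (c (real k) x + B)) = ennreal B"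
        by (intro lim_imp_Limsup) auto
      moreover have "limsup (\<lambda>k. ?u k x) \<le> limsup (\<lambda>k. ennreal (c (real k) x + B))"
        by (intro Limsup_mono always_eventually allI order_trans[OF nn_integral_mono le]) auto
      ultimately show "limsup (\<lambda>k. ?u k x) \<le> ennreal B"
        by simp
    qed
    finally show ?thesis
      using emeasure_space_1 by simp
  qed
  \<comment> \<open>The levels \<open>of_nat n\<close> have supremum infinity, so the truncations
    recover \<open>h\<close> even where it is infinite.\<close>
  have "(SUP n. inf (h x) (of_nat n)) = h x" for x
    by (simp add: inf_SUP[symmetric] ennreal_SUP_of_nat_eq_top)
  then have "(\<integral>\<^sup>+x. h x \<partial>\<mu>) = (\<integral>\<^sup>+x. (SUP n. inf (h x) (of_nat n)) \<partial>\<mu>)"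
    by simp
  also have "\<dots> = (SUP n. \<integral>\<^sup>+x. inf (h x) (of_nat n) \<partial>\<mu>)"
    by (rule nn_integral_monotone_convergence_SUP)
      (auto simp: incseq_def le_fun_def intro!: le_infI2 of_nat_mono)
  also have "\<dots> \<le> ennreal B"
    using trunc by (rule SUP_least)
  finally show ?thesis .
qed

end

section \<open>The corrector of a mixing observable\<close>

text \<open>\<open>f\<close> stands for the centred observable and \<open>W x\<close> for the
  constant in its exponential decay from the starting point \<open>x\<close>. \<open>W\<close> may
  be unbounded; its square integrability under \<open>\<mu>\<close> and every \<open>P t x\<close>
  is what places the corrector in \<open>Lspace\<close>.\<close>

locale mixing_observable = invariant_markov_semigroup P \<mu>
  for P :: "real \<Rightarrow> 'a::polish_space \<Rightarrow> 'a measure" and \<mu> :: "'a measure" +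
  fixes f W :: "'a \<Rightarrow> real" and K \<gamma> :: real
  assumes f_meas [measurable]: "f \<in> borel_measurable borel"
    and f_le: "\<And>x. \<bar>f x\<bar> \<le> K"
    and f_cont: "\<And>x. ((\<lambda>t. Pf P t f x) \<longlongrightarrow> f x) (at_right 0)"
    and \<gamma>_pos: "\<gamma> > 0"
    and W_meas [measurable]: "W \<in> borel_measurable borel"
    and decay: "\<And>t x. t \<ge> 0 \<Longrightarrow> \<bar>Pf P t f x\<bar> \<le> exp (- \<gamma> * t) * W x"
    and W2_mu: "integrable \<mu> (\<lambda>x. (W x)\<^sup>2)"
    and W2_P: "\<And>t x. t \<ge> 0 \<Longrightarrow> integrable (P t x) (\<lambda>x. (W x)\<^sup>2)"
begin

lemma W_nonneg: "0 \<le> W x"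
  using order_trans[OF abs_ge_zero decay[of 0 x]] by simp

lemma K_nonneg: "0 \<le> K"
  using order_trans[OF abs_ge_zero f_le] .

text \<open>Right continuity at 0 spreads to every \<open>t\<close> through
  \<open>P (t + r) f = P t (P r f)\<close> and dominated convergence with the bound
  \<open>K\<close>.\<close>

lemma Pf_right_continuous:
  assumes "t \<ge> 0"
  shows "((\<lambda>s. Pf P s f x) \<longlongrightarrow> Pf P t f x) (at_right t)"
proof (rule tendsto_at_right_sequentially[of _ "t + 1"])
  fix S :: "nat \<Rightarrow> real"
  assume S: "\<And>n. t < S n" "S \<longlonglongrightarrow> t"
  interpret prob_space "P t x" by (rule prob_space_P[OF assms])
  have "(\<lambda>n. \<integral>y. Pf P (S n - t) f y \<partial>P t x) \<longlonglongrightarrow> (\<integral>y. f y \<partial>P t x)"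
  proof (rule integral_dominated_convergence[where w = "\<lambda>_. K"])
    have "(\<lambda>n. S n - t) \<longlonglongrightarrow> 0"
      using tendsto_diff[OF S(2) tendsto_const, of t] by simp
    then have "filterlim (\<lambda>n. S n - t) (at_right 0) sequentially"
      by (rule tendsto_imp_filterlim_at_right) (use S(1) in simp)
    then show "AE y in P t x. (\<lambda>n. Pf P (S n - t) f y) \<longlonglongrightarrow> f y"
      using filterlim_compose[OF f_cont] by auto
    show "AE y in P t x. norm (Pf P (S n - t) f y) \<le> K" for n
      using S(1)[of n] f_le by (intro AE_I2) (auto intro!: Pf_abs_le)
  qed (use less_imp_le[OF S(1)] assms in \<open>auto intro!: measurable_P measurable_Pf\<close>)
  moreover have "Pf P (S n) f x = (\<integral>y. Pf P (S n - t) f y \<partial>P t x)" for n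
  proof -
    have "integrable (P (t + (S n - t)) x) f"
      using S(1)[of n] assms f_le by (intro integrable_P_bounded[where K = K]) auto
    then have "Pf P (t + (S n - t)) f x = Pf P t (Pf P (S n - t) f) x"
      using S(1)[of n] assms by (intro Pf_add) auto
    then show ?thesis
      by (simp add: Pf_def[of P t])
  qed
  ultimately show "(\<lambda>n. Pf P (S n) f x) \<longlonglongrightarrow> Pf P t f x"
    by (simp add: Pf_def[of P t])
qed simp

text \<open>\<open>P t f\<close> extended by 0 to negative times, so that integrals run over all of
  \<open>lborel\<close> and can be shifted. The extension jumps at 0 only from the left and is still
  right continuous everywhere, which yields its joint measurability.\<close>

definition q :: "real \<Rightarrow> 'a \<Rightarrow> real" where
  "q t x = indicator {0..} t * Pf P t f x"

lemma measurable_q: "(\<lambda>(t, x). q t x) \<in> borel_measurable (borel \<Otimes>\<^sub>M borel)"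
proof (rule borel_measurable_right_continuous)
  show "q t \<in> borel_measurable borel" for t
    unfolding q_def by (cases "t \<ge> 0") (auto simp: indicator_def)
  show "((\<lambda>s. q s x) \<longlongrightarrow> q t x) (at_right t)" for t x
  proof (cases "t \<ge> 0")
    case True
    have "eventually (\<lambda>s. Pf P s f x = q s x) (at_right t)"
      by (rule eventually_mono[OF eventually_at_right_less]) (use True in \<open>simp add: q_def\<close>)
    from Lim_transform_eventually[OF Pf_right_continuous[OF True] this] show ?thesis
      using True by (simp add: q_def)
  next
    case False
    then have "eventually (\<lambda>s. s < 0) (at_right t)"
      by (auto simp: eventually_at_right_field intro!: exI[of _ 0])
    then have "eventually (\<lambda>s. 0 = q s x) (at_right t)"
      by eventually_elim (simp add: q_def)
    from Lim_transform_eventually[OF tendsto_const this] show ?thesis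
      using False by (simp add: q_def)
  qed
qed

lemma measurable_q' [measurable (raw)]:
  assumes [measurable]: "u \<in> borel_measurable N" "v \<in> N \<rightarrow>\<^sub>M borel"
  shows "(\<lambda>z. q (u z) (v z)) \<in> borel_measurable N"
  using measurable_compose[OF measurable_Pair[OF assms] measurable_q] by simp

lemma q_le: "\<bar>q t x\<bar> \<le> K"
  using Pf_abs_le[of t f K x] f_le order_trans[OF abs_ge_zero f_le]
  by (auto simp: q_def indicator_def)

definition e :: "real \<Rightarrow> real" where
  "e t = indicator {0..} t * exp (- \<gamma> * t)"

lemma e_eq: "e t = exponential_density \<gamma> t / \<gamma>"
  using \<gamma>_pos by (simp add: e_def exponential_density_def indicator_def mult.commute)

text \<open>Up to the factor \<open>1 / \<gamma>\<close>, \<open>e\<close> is the density of the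
  exponential distribution, whose total mass is 1.\<close>

lemma integrable_e: "integrable lborel e" and integral_e: "(\<integral>t. e t \<partial>lborel) = 1 / \<gamma>"
proof -
  interpret prob_space "density lborel (exponential_density \<gamma>)"
    by (rule prob_space_exponential_density[OF \<gamma>_pos])
  have "has_bochner_integral lborel (exponential_density \<gamma>) 1"
    using emeasure_space_1 exponential_density_nonneg[OF \<gamma>_pos]
    by (intro has_bochner_integral_nn_integral) (auto simp: emeasure_density)
  from has_bochner_integral_divide_zero[OF this, of \<gamma>]
  show "integrable lborel e" "(\<integral>t. e t \<partial>lborel) = 1 / \<gamma>"
    by (auto simp: has_bochner_integral_iff e_eq[abs_def])
qed

lemma e_nonneg: "0 \<le> e t"
  by (simp add: e_def)

lemma q_decay: "\<bar>q t x\<bar> \<le> e t * W x"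
  unfolding e_def q_def using decay[of t x] by (auto simp: indicator_def)

lemma integrable_q: "integrable lborel (\<lambda>t. q t x)"
  by (rule Bochner_Integration.integrable_bound[OF integrable_mult_left[OF integrable_e, of "W x"]])
    (use q_decay e_nonneg W_nonneg in \<open>auto simp: abs_mult\<close>)

lemma integrable_indicator_q: "S \<in> sets borel \<Longrightarrow> integrable lborel (\<lambda>t. indicator S t * q t x)"
  using integrable_mult_indicator[OF _ integrable_q, of S x] by simp

text \<open>The potential of \<open>f\<close>: it solves the Poisson equation, the generator sending
  it to \<open>- f\<close>.\<close>

definition chi :: "'a \<Rightarrow> real" where
  "chi x = (LBINT t:{0..}. Pf P t f x)"

lemma chi_eq: "chi x = (\<integral>t. q t x \<partial>lborel)"
  by (simp add: chi_def q_def set_lebesgue_integral_def)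

lemma measurable_chi [measurable]: "chi \<in> borel_measurable borel"
  unfolding chi_eq[abs_def] by measurable

lemma chi_le: "\<bar>chi x\<bar> \<le> W x / \<gamma>"
proof -
  have "\<bar>chi x\<bar> \<le> (\<integral>t. \<bar>q t x\<bar> \<partial>lborel)"
    unfolding chi_eq by (rule integral_abs_bound)
  also have "\<dots> \<le> (\<integral>t. e t * W x \<partial>lborel)"
    using integrable_q integrable_e q_decay by (intro integral_mono) auto
  also have "\<dots> = W x / \<gamma>"
    using integral_e by simp
  finally show ?thesis .
qed

lemma chi2_le: "(chi x)\<^sup>2 \<le> (W x)\<^sup>2 / \<gamma>\<^sup>2"
  using power_mono[OF chi_le, of x 2] by (simp add: power_divide)

lemma integrable_chi2_mu: "integrable \<mu> (\<lambda>x. (chi x)\<^sup>2)"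
  using W2_mu by (rule Bochner_Integration.integrable_bound[OF integrable_divide[of _ _ "\<gamma>\<^sup>2"]])
    (use chi2_le in auto)

lemma integrable_chi2_P: "t \<ge> 0 \<Longrightarrow> integrable (P t x) (\<lambda>x. (chi x)\<^sup>2)"
  by (rule Bochner_Integration.integrable_bound[OF integrable_divide[OF W2_P, of _ _ "\<gamma>\<^sup>2"]])
    (use chi2_le in \<open>auto simp: measurable_P\<close>)

lemma integrable_W_mu: "integrable \<mu> W"
proof -
  interpret prob_space \<mu> by (rule prob_space_mu)
  show ?thesis
    by (rule square_integrable_imp_integrable) (use W2_mu in auto)
qed

lemma integrable_W_P: "t \<ge> 0 \<Longrightarrow> integrable (P t x) W"
proof -
  assume t: "t \<ge> 0"
  interpret prob_space "P t x" by (rule prob_space_P[OF t])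
  show ?thesis
    by (rule square_integrable_imp_integrable) (use W2_P t in \<open>auto simp: measurable_P\<close>)
qed

lemma integrable_chi_mu: "integrable \<mu> chi"
  using integrable_W_mu by (rule Bochner_Integration.integrable_bound[OF integrable_divide[of _ _ "\<gamma>"]])
    (use chi_le W_nonneg \<gamma>_pos in auto)

text \<open>Fubini, with the majorant \<open>e s * W y\<close>, moves \<open>P t\<close> under the
  time integral; the semigroup law turns \<open>P t (P s f)\<close> into \<open>P (t + s) f\<close>,
  and shifting time leaves the tail of the integral beyond \<open>t\<close>.\<close>

lemma Pf_chi:
  assumes t: "t \<ge> 0"
  shows "Pf P t chi x = (\<integral>s. indicator {t..} s * q s x \<partial>lborel)"
proof -
  interpret Px: prob_space "P t x" by (rule prob_space_P[OF t])
  interpret pair_sigma_finite lborel "P t x" ..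
  have [measurable_cong]: "sets (P t x) = sets borel"
    by (rule sets_P[OF t])
  have int: "integrable (lborel \<Otimes>\<^sub>M P t x) (\<lambda>(s, y). q s y)"
  proof (rule Fubini_integrable)
    show "AE s in lborel. integrable (P t x) (\<lambda>y. case (s, y) of (s, y) \<Rightarrow> q s y)"
      using t q_le by (auto intro!: integrable_P_bounded[where K = K])
    show "integrable lborel (\<lambda>s. \<integral>y. norm (case (s, y) of (s, y) \<Rightarrow> q s y) \<partial>P t x)"
    proof (rule Bochner_Integration.integrable_bound)
      show "integrable lborel (\<lambda>s. e s * (\<integral>y. W y \<partial>P t x))"
        using integrable_e by auto
      show "AE s in lborel. norm (\<integral>y. norm (case (s, y) of (s, y) \<Rightarrow> q s y) \<partial>P t x) \<le> norm (e s * (\<integral>y. W y \<partial>P t x))"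
      proof (rule AE_I2)
        fix s
        have "(\<integral>y. \<bar>q s y\<bar> \<partial>P t x) \<le> (\<integral>y. e s * W y \<partial>P t x)"
        proof (rule integral_mono)
          show "integrable (P t x) (\<lambda>y. \<bar>q s y\<bar>)"
            using t q_le by (intro integrable_P_bounded[where K = K]) auto
        qed (use integrable_W_P[OF t] q_decay in auto)
        then show "norm (\<integral>y. norm (case (s, y) of (s, y) \<Rightarrow> q s y) \<partial>P t x) \<le> norm (e s * (\<integral>y. W y \<partial>P t x))"
          by simp
      qed
    qed measurable
  qed measurable
  have "Pf P t chi x = (\<integral>y. \<integral>s. q s y \<partial>lborel \<partial>P t x)"
    by (simp add: Pf_def chi_eq)
  also have "\<dots> = (\<integral>s. \<integral>y. q s y \<partial>P t x \<partial>lborel)"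
    using Fubini_integral[OF int] by simp
  \<comment> \<open>The indicator handles \<open>s < 0\<close>, where \<open>q s\<close> vanishes
    but \<open>q (t + s) x\<close> need not.\<close>
  also have "\<dots> = (\<integral>s. indicator {t..} (t + s) * q (t + s) x \<partial>lborel)"
  proof (rule Bochner_Integration.integral_cong[OF refl])
    fix s :: real
    show "(\<integral>y. q s y \<partial>P t x) = indicator {t..} (t + s) * q (t + s) x"
    proof (cases "s \<ge> 0")
      case True
      then have "(\<integral>y. q s y \<partial>P t x) = Pf P t (Pf P s f) x"
        by (simp add: q_def Pf_def)
      also have "\<dots> = Pf P (t + s) f x"
        using t True f_le by (intro Pf_add[symmetric] integrable_P_bounded[where K = K]) auto
      finally show ?thesis
        using True t by (simp add: q_def)
    qed (simp add: q_def)
  qed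
  also have "\<dots> = (\<integral>s. indicator {t..} s * q s x \<partial>lborel)"
    by (rule lborel_shift)
  finally show ?thesis .
qed

lemma chi_minus_Pf_chi:
  assumes t: "t \<ge> 0"
  shows "chi x - Pf P t chi x = (\<integral>s. indicator {0..t} s * q s x \<partial>lborel)"
proof -
  have "chi x - Pf P t chi x = (\<integral>s. q s x - indicator {t..} s * q s x \<partial>lborel)"
    using integrable_q integrable_indicator_q[of "{t..}"] by (simp add: chi_eq Pf_chi[OF t])
  also have "\<dots> = (\<integral>s. indicator {0..t} s * q s x \<partial>lborel)"
  proof (rule integral_cong_AE)
    show "AE s in lborel. q s x - indicator {t..} s * q s x = indicator {0..t} s * q s x"
      using AE_lborel_singleton[of t] by eventually_elim (use t in \<open>auto simp: indicator_def q_def\<close>)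
  qed measurable
  finally show ?thesis .
qed

text \<open>Although \<open>chi\<close> may be unbounded, its increments under the semigroup are
  bounded uniformly in \<open>x\<close>, because they only involve \<open>f\<close> over a time span
  \<open>t\<close>. This supplies the majorants for the generator limit and for products with
  \<open>chi\<close>.\<close>

lemma chi_minus_Pf_chi_le:
  assumes t: "t \<ge> 0"
  shows "\<bar>chi x - Pf P t chi x\<bar> \<le> t * K"
proof -
  have "\<bar>chi x - Pf P t chi x\<bar> \<le> (\<integral>s. \<bar>indicator {0..t} s * q s x\<bar> \<partial>lborel)"
    unfolding chi_minus_Pf_chi[OF t] by (rule integral_abs_bound)
  also have "\<dots> \<le> (\<integral>s. indicator {0..t} s * K \<partial>lborel)"
  proof (rule integral_mono)
    show "integrable lborel (\<lambda>s. indicator {0..t} s * K)"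
      using t by (intro integrable_mult_left integrable_real_indicator) auto
    show "\<bar>indicator {0..t} s * q s x\<bar> \<le> indicator {0..t} s * K" for s
      using q_le by (auto simp: indicator_def)
  qed (use integrable_indicator_q[of "{0..t}" x] in auto)
  also have "\<dots> = t * K"
    using t by simp
  finally show ?thesis .
qed

lemma integrable_f2: "integrable \<mu> (\<lambda>x. (f x)\<^sup>2)" "t \<ge> 0 \<Longrightarrow> integrable (P t x) (\<lambda>x. (f x)\<^sup>2)"
proof -
  have le: "\<bar>(f x)\<^sup>2\<bar> \<le> K\<^sup>2" for x
    using power_mono[OF f_le, of x 2] by simp
  interpret prob_space \<mu> by (rule prob_space_mu)
  show "integrable \<mu> (\<lambda>x. (f x)\<^sup>2)"
    using le by (intro integrable_const_bound[of _ "K\<^sup>2"]) auto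
  show "t \<ge> 0 \<Longrightarrow> integrable (P t x) (\<lambda>x. (f x)\<^sup>2)"
    using le by (intro integrable_P_bounded[where K = "K\<^sup>2"]) auto
qed

section \<open>The generator at the corrector\<close>

lemma chi_in_L0space: "chi \<in> L0space P \<mu>"
  unfolding L0space_def Lspace_def
proof (intro CollectI conjI allI impI norm2_tendsto_0[where K = K])
  show "\<bar>Pf P t chi x - chi x\<bar> \<le> K" if "0 < t" "t < 1" for t x
    using chi_minus_Pf_chi_le[of t x] mult_right_mono[of t 1 K] that K_nonneg by (simp add: abs_minus_commute)
  show "((\<lambda>t. Pf P t chi x - chi x) \<longlongrightarrow> 0) (at_right 0)" for x
  proof (rule Lim_null_comparison)
    show "eventually (\<lambda>t. norm (Pf P t chi x - chi x) \<le> t * K) (at_right 0)"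
      by (rule eventually_mono[OF eventually_at_right_less])
        (use chi_minus_Pf_chi_le in \<open>simp add: abs_minus_commute\<close>)
    show "((\<lambda>t. t * K) \<longlongrightarrow> 0) (at_right 0)"
      by (auto intro!: tendsto_eq_intros)
  qed
qed (auto simp: integrable_chi2_mu integrable_chi2_P)

lemma Pf_minus: "Pf P t (\<lambda>x. - f x) x = - Pf P t f x"
  by (simp add: Pf_def)

lemma minus_f_in_L0space: "(\<lambda>x. - f x) \<in> L0space P \<mu>"
  unfolding L0space_def Lspace_def
proof (intro CollectI conjI allI impI norm2_tendsto_0[where K = "2 * K"])
  show "\<bar>Pf P t (\<lambda>x. - f x) x - - f x\<bar> \<le> 2 * K" if "0 < t" for t x
    using Pf_abs_le[OF less_imp_le[OF that] f_meas f_le, of x] f_le[of x] by (simp add: Pf_minus)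
  show "((\<lambda>t. Pf P t (\<lambda>x. - f x) x - - f x) \<longlongrightarrow> 0) (at_right 0)" for x
    using tendsto_diff[OF tendsto_const f_cont, of "f x" x] by (simp add: Pf_minus)
qed (auto simp: integrable_f2)

lemma difference_quotient_bound:
  assumes "t > 0"
  shows "\<bar>(Pf P t chi x - chi x) / t\<bar> \<le> K"
  using chi_minus_Pf_chi_le[of t x] assms by (simp add: abs_minus_commute pos_divide_le_eq mult.commute)

lemma q_tendsto: "((\<lambda>t. q t x) \<longlongrightarrow> f x) (at_right 0)"
proof (rule Lim_transform_eventually[OF f_cont])
  show "eventually (\<lambda>t. Pf P t f x = q t x) (at_right 0)"
    by (rule eventually_mono[OF eventually_at_right_less]) (simp add: q_def)
qed

text \<open>The difference quotient is minus the average of \<open>P s f x\<close> over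
  \<open>{0..t}\<close>, which tends to \<open>- f x\<close> at every point. It is bounded by
  \<open>K\<close>, so its distance to \<open>- f x\<close> is at most \<open>2 * K\<close> and
  bounded convergence gives the L2 limit.\<close>

theorem gen_limit_chi: "gen_limit P \<mu> chi (\<lambda>x. - f x)"
  unfolding gen_limit_def
proof (intro conjI minus_f_in_L0space norm2_tendsto_0[where K = "2 * K"])
  show "\<bar>(Pf P t chi x - chi x) / t - - f x\<bar> \<le> 2 * K" if "0 < t" for t x
    using difference_quotient_bound[OF that, of x] f_le[of x] by linarith
  show "((\<lambda>t. (Pf P t chi x - chi x) / t - - f x) \<longlongrightarrow> 0) (at_right 0)" for x
  proof (rule Lim_transform_eventually)
    show "((\<lambda>t. f x - (\<integral>s. indicator {0..t} s * q s x \<partial>lborel) / t) \<longlongrightarrow> 0) (at_right 0)"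
      using tendsto_diff[OF tendsto_const average_tendsto_at_right_0[OF integrable_q q_tendsto], of "f x" x]
      by simp
    show "eventually (\<lambda>t. f x - (\<integral>s. indicator {0..t} s * q s x \<partial>lborel) / t = (Pf P t chi x - chi x) / t - - f x) (at_right 0)"
      by (rule eventually_mono[OF eventually_at_right_less])
        (simp add: chi_minus_Pf_chi[symmetric] diff_divide_distrib)
  qed
qed auto

lemma chi_in_gen_dom: "chi \<in> gen_dom P \<mu>"
  using chi_in_L0space gen_limit_chi by (auto simp: gen_dom_def)

lemma gen_limit_generator: "gen_limit P \<mu> chi (generator P \<mu> chi)"
  unfolding generator_def by (rule someI[of "gen_limit P \<mu> chi"]) (rule gen_limit_chi)

text \<open>\<open>generator\<close> picks some L2 limit, so it can be identified only almost
  everywhere. Two limits of the same quotient \<open>?D t\<close> have L2 distance 0, since the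
  squared distance is at most twice the sum of the squared distances to \<open>?D t\<close>.\<close>

lemma generator_chi: "AE x in \<mu>. generator P \<mu> chi x = - f x"
proof -
  interpret prob_space \<mu> by (rule prob_space_mu)
  let ?h = "generator P \<mu> chi" and ?D = "\<lambda>t x. (Pf P t chi x - chi x) / t"
  note lim = gen_limit_generator
  then have [measurable]: "?h \<in> borel_measurable borel" and h2: "integrable \<mu> (\<lambda>x. (?h x)\<^sup>2)"
    by (auto simp: gen_limit_def L0space_def Lspace_def)
  have mD: "?D t \<in> borel_measurable \<mu>" if "t > 0" for t
    using less_imp_le[OF that] by measurable
  have D2: "integrable \<mu> (\<lambda>x. (?D t x)\<^sup>2)" if "t > 0" for t
  proof (rule integrable_const_bound[of _ "K\<^sup>2"])
    have "(?D t x)\<^sup>2 \<le> K\<^sup>2" for x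
      using power_mono[OF difference_quotient_bound[OF that], of x 2] by (simp only: power2_abs abs_ge_zero)
    then show "AE x in \<mu>. norm ((?D t x)\<^sup>2) \<le> K\<^sup>2"
      by simp
  qed (use mD[OF that] in simp)
  have hf: "integrable \<mu> (\<lambda>x. (?h x - - f x)\<^sup>2)"
    using integrable_f2 h2 by (intro integrable_square_diff) auto
  have "((\<lambda>t. 2 * (norm2 \<mu> (\<lambda>x. ?D t x - ?h x))\<^sup>2 + 2 * (norm2 \<mu> (\<lambda>x. ?D t x - - f x))\<^sup>2) \<longlongrightarrow> 2 * 0\<^sup>2 + 2 * 0\<^sup>2) (at_right 0)"
    using lim gen_limit_chi unfolding gen_limit_def by (intro tendsto_intros) auto
  moreover have "eventually (\<lambda>t. (\<integral>x. (?h x - - f x)\<^sup>2 \<partial>\<mu>) \<le>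
      2 * (norm2 \<mu> (\<lambda>x. ?D t x - ?h x))\<^sup>2 + 2 * (norm2 \<mu> (\<lambda>x. ?D t x - - f x))\<^sup>2) (at_right 0)"
  proof (rule eventually_mono[OF eventually_at_right_less])
    fix t :: real assume t: "0 < t"
    have i1: "integrable \<mu> (\<lambda>x. (?D t x - ?h x)\<^sup>2)"
      using D2[OF t] h2 mD[OF t] by (intro integrable_square_diff) auto
    have i2: "integrable \<mu> (\<lambda>x. (?D t x - - f x)\<^sup>2)"
      using D2[OF t] integrable_f2 mD[OF t] by (intro integrable_square_diff) auto
    \<comment> \<open>The parallelogram law for \<open>d - a\<close> and \<open>d - b\<close>, with
      the square of their sum dropped.\<close>
    have sq: "(a - b)\<^sup>2 \<le> 2 * (d - a)\<^sup>2 + 2 * (d - b)\<^sup>2" for a b d :: real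
      using zero_le_power2[of "(d - a) + (d - b)"] by (simp add: power2_eq_square algebra_simps)
    have "(\<integral>x. (?h x - - f x)\<^sup>2 \<partial>\<mu>) \<le> (\<integral>x. 2 * (?D t x - ?h x)\<^sup>2 + 2 * (?D t x - - f x)\<^sup>2 \<partial>\<mu>)"
      by (rule integral_mono[OF hf _ sq])
        (intro Bochner_Integration.integrable_add integrable_mult_right i1 i2)
    also have "\<dots> = 2 * (\<integral>x. (?D t x - ?h x)\<^sup>2 \<partial>\<mu>) + 2 * (\<integral>x. (?D t x - - f x)\<^sup>2 \<partial>\<mu>)"
      using i1 i2 by (subst Bochner_Integration.integral_add) auto
    finally show "(\<integral>x. (?h x - - f x)\<^sup>2 \<partial>\<mu>) \<le>
        2 * (norm2 \<mu> (\<lambda>x. ?D t x - ?h x))\<^sup>2 + 2 * (norm2 \<mu> (\<lambda>x. ?D t x - - f x))\<^sup>2"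
      by (simp add: norm2_def del: diff_minus_eq_add)
  qed
  ultimately have "(\<integral>x. (?h x - - f x)\<^sup>2 \<partial>\<mu>) \<le> 0"
    using tendsto_lowerbound[of _ 0 "at_right (0::real)" "\<integral>x. (?h x - - f x)\<^sup>2 \<partial>\<mu>"] by simp
  then have "(\<integral>x. (?h x - - f x)\<^sup>2 \<partial>\<mu>) = 0"
    by (intro antisym Bochner_Integration.integral_nonneg) auto
  then have "AE x in \<mu>. (?h x - - f x)\<^sup>2 = 0"
    using integral_nonneg_eq_0_iff_AE[OF hf] by auto
  then show ?thesis
    by eventually_elim simp
qed

lemma integral_chi_generator: "(\<integral>x. chi x * generator P \<mu> chi x \<partial>\<mu>) = - (\<integral>x. chi x * f x \<partial>\<mu>)"
proof -
  have [measurable]: "generator P \<mu> chi \<in> borel_measurable borel"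
    using gen_limit_generator by (auto simp: gen_limit_def L0space_def Lspace_def)
  have "(\<integral>x. chi x * generator P \<mu> chi x \<partial>\<mu>) = (\<integral>x. - (chi x * f x) \<partial>\<mu>)"
    by (rule integral_cong_AE) (use generator_chi in \<open>auto elim!: eventually_mono\<close>)
  then show ?thesis
    by simp
qed

end

section \<open>The stationary process\<close>

locale stationary_markov_process = invariant_markov_semigroup P \<mu>
  for P :: "real \<Rightarrow> 'a::polish_space \<Rightarrow> 'a measure" and \<mu> :: "'a measure" +
  fixes M :: "'w measure" and X :: "real \<Rightarrow> 'w \<Rightarrow> 'a"
  assumes prob: "prob_space M"
    and Xmeas: "\<And>t. t \<ge> 0 \<Longrightarrow> X t \<in> M \<rightarrow>\<^sub>M borel"
    and Xjoint: "(\<lambda>(t, \<omega>). X t \<omega>) \<in> borel_measurable (restrict_space lborel {0..} \<Otimes>\<^sub>M M)"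
    and markov: "\<And>s t Bs E. s \<ge> 0 \<Longrightarrow> t \<ge> 0 \<Longrightarrow> Bs \<in> sets borel \<Longrightarrow> E \<in> sets (nat_filt M X s) \<Longrightarrow>
        measure M (E \<inter> X (s + t) -` Bs \<inter> space M) = (LINT \<omega>:E|M. measure (P t (X s \<omega>)) Bs)"
    and init: "distr M borel (X 0) = \<mu>"
begin

lemma in_nat_filt:
  assumes "0 \<le> s" "A \<in> sets borel"
  shows "X s -` A \<inter> space M \<in> sets (nat_filt M X s)"
proof -
  have "{X r -` B \<inter> space M | r B. 0 \<le> r \<and> r \<le> s \<and> B \<in> sets borel} \<subseteq> Pow (space M)"
    by auto
  then have "sets (nat_filt M X s) = sigma_sets (space M) {X r -` B \<inter> space M | r B. 0 \<le> r \<and> r \<le> s \<and> B \<in> sets borel}"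
    unfolding nat_filt_def by (rule sets_measure_of)
  then show ?thesis
    using assms by (auto intro!: sigma_sets.Basic)
qed

text \<open>The Markov property for the past event that \<open>X s\<close> lies in \<open>A\<close>.
  The law of \<open>X s\<close> is a hypothesis because the case \<open>s = 0\<close>, where
  \<open>init\<close> supplies it, is used to prove stationarity; afterwards it holds for all
  \<open>s\<close>.\<close>

lemma measure_X_pair:
  assumes s: "0 \<le> s" and t: "0 \<le> t" and A: "A \<in> sets borel" and B: "B \<in> sets borel"
    and law: "distr M borel (X s) = \<mu>"
  shows "measure M (X s -` A \<inter> X (s + t) -` B \<inter> space M) = (\<integral>x. indicator A x * measure (P t x) B \<partial>\<mu>)"
proof -
  have [measurable]: "X s \<in> M \<rightarrow>\<^sub>M borel"
    by (rule Xmeas[OF s])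
  have [measurable]: "(\<lambda>x. measure (P t x) B) \<in> borel_measurable borel"
    by (rule measurable_compose[OF kernel[OF t]]) (use B in measurable)
  have "X s -` A \<inter> X (s + t) -` B \<inter> space M = (X s -` A \<inter> space M) \<inter> X (s + t) -` B \<inter> space M"
    by auto
  then have "measure M (X s -` A \<inter> X (s + t) -` B \<inter> space M) = (LINT \<omega>:X s -` A \<inter> space M|M. measure (P t (X s \<omega>)) B)"
    using markov[OF s t B in_nat_filt[OF s A]] by simp
  also have "\<dots> = (\<integral>\<omega>. indicator A (X s \<omega>) * measure (P t (X s \<omega>)) B \<partial>M)"
    unfolding set_lebesgue_integral_def by (intro Bochner_Integration.integral_cong) (auto simp: indicator_def)
  also have "\<dots> = (\<integral>x. indicator A x * measure (P t x) B \<partial>distr M borel (X s))"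
    using A by (subst integral_distr) auto
  finally show ?thesis
    by (simp add: law)
qed

text \<open>A bridge between the real measures in \<open>markov\<close> and the extended ones in the
  formula for \<open>bind\<close>.\<close>

lemma integral_indicator_measure_P:
  assumes t: "0 \<le> t" and A: "A \<in> sets borel" and B: "B \<in> sets borel"
  shows "(\<integral>x. indicator A x * measure (P t x) B \<partial>\<mu>) = enn2real (\<integral>\<^sup>+x. indicator A x * emeasure (P t x) B \<partial>\<mu>)"
proof -
  have [measurable]: "(\<lambda>x. measure (P t x) B) \<in> borel_measurable borel"
    by (rule measurable_compose[OF kernel[OF t]]) (use B in measurable)
  have "ennreal (indicator A x * measure (P t x) B) = indicator A x * emeasure (P t x) B" for x
  proof -
    interpret prob_space "P t x" by (rule prob_space_P[OF t])
    show ?thesis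
      by (simp add: emeasure_eq_measure indicator_def)
  qed
  then show ?thesis
    using A by (subst integral_eq_nn_integral) auto
qed

text \<open>Stationarity: the pair formula at \<open>s = 0\<close> with \<open>A = UNIV\<close>,
  followed by invariance of \<open>\<mu>\<close>.\<close>

lemma law_X:
  assumes t: "0 \<le> t"
  shows "distr M borel (X t) = \<mu>"
proof (rule measure_eqI)
  interpret M: prob_space M by (rule prob)
  interpret \<mu>: prob_space \<mu> by (rule prob_space_mu)
  fix B assume "B \<in> sets (distr M borel (X t))"
  then have B: "B \<in> sets borel" by simp
  have "measure M (X t -` B \<inter> space M) = enn2real (\<integral>\<^sup>+x. emeasure (P t x) B \<partial>\<mu>)"
    using measure_X_pair[of 0 t UNIV B] integral_indicator_measure_P[OF t _ B, of UNIV] t B init by simp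
  also have "(\<integral>\<^sup>+x. emeasure (P t x) B \<partial>\<mu>) = emeasure (\<mu> \<bind> P t) B"
    by (rule emeasure_bind[symmetric, OF _ subprob_kernel_mu[OF t] B]) simp
  finally have "measure M (X t -` B \<inter> space M) = measure \<mu> B"
    by (simp add: mu_inv[OF t] measure_def)
  then show "emeasure (distr M borel (X t)) B = emeasure \<mu> B"
    using Xmeas[OF t] B by (simp add: emeasure_distr M.emeasure_eq_measure \<mu>.emeasure_eq_measure)
qed simp

lemma
  fixes u :: "'a \<Rightarrow> real"
  assumes t: "0 \<le> t" and u [measurable]: "u \<in> borel_measurable borel"
  shows integral_X: "(\<integral>\<omega>. u (X t \<omega>) \<partial>M) = (\<integral>x. u x \<partial>\<mu>)"
    and integrable_X: "integrable M (\<lambda>\<omega>. u (X t \<omega>)) \<longleftrightarrow> integrable \<mu> u"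
  using integral_distr[OF Xmeas[OF t] u] integrable_distr_eq[OF Xmeas[OF t] u] law_X[OF t] by auto

text \<open>The right side draws \<open>x\<close> from \<open>\<mu>\<close> and then the second
  coordinate from \<open>P (t - s) x\<close>. By the Markov property and stationarity both laws
  agree on rectangles, an intersection-stable generator containing the whole space, and finite
  measures are determined there.\<close>

lemma
  assumes s: "0 \<le> s" and st: "s \<le> t"
  shows law_X_pair: "distr M (borel \<Otimes>\<^sub>M borel) (\<lambda>\<omega>. (X s \<omega>, X t \<omega>)) =
    \<mu> \<bind> (\<lambda>x. distr (P (t - s) x) (borel \<Otimes>\<^sub>M borel) (Pair x))"
    (is "?L = ?R")
    and measurable_pair_kernel: "(\<lambda>x. distr (P (t - s) x) (borel \<Otimes>\<^sub>M borel) (Pair x)) \<in> \<mu> \<rightarrow>\<^sub>M subprob_algebra (borel \<Otimes>\<^sub>M borel)"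
proof -
  interpret M: prob_space M by (rule prob)
  have t: "0 \<le> t" and ts: "0 \<le> t - s"
    using s st by auto
  have [measurable]: "X s \<in> M \<rightarrow>\<^sub>M borel" "X t \<in> M \<rightarrow>\<^sub>M borel"
    using Xmeas s t by auto
  have "(\<lambda>x. distr (P (t - s) x) (borel \<Otimes>\<^sub>M borel) (Pair x)) \<in> borel \<rightarrow>\<^sub>M subprob_algebra (borel \<Otimes>\<^sub>M borel)"
    by (rule measurable_prob_algebraD, rule measurable_distr_prob_space2[OF kernel[OF ts]]) simp
  then show N: "(\<lambda>x. distr (P (t - s) x) (borel \<Otimes>\<^sub>M borel) (Pair x)) \<in> \<mu> \<rightarrow>\<^sub>M subprob_algebra (borel \<Otimes>\<^sub>M borel)"
    by (simp cong: measurable_cong_sets)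
  have sets_R: "sets ?R = sets (borel \<Otimes>\<^sub>M borel)"
    by (rule sets_bind) (use subprob_measurableD(2)[OF N] in auto)
  show "?L = ?R"
  proof (rule measure_eqI_generator_eq[where E = "{a \<times> b | a b. a \<in> sets borel \<and> b \<in> sets borel}"
        and A = "\<lambda>_. UNIV" and \<Omega> = UNIV])
    show "Int_stable {a \<times> b | a b. a \<in> sets (borel :: 'a measure) \<and> b \<in> sets (borel :: 'a measure)}"
      using Int_stable_pair_measure_generator[of "borel :: 'a measure" "borel :: 'a measure"] .
    show "sets ?L = sigma_sets UNIV {a \<times> b | a b. a \<in> sets borel \<and> b \<in> sets borel}"
      by (simp add: sets_pair_measure)
    show "sets ?R = sigma_sets UNIV {a \<times> b | a b. a \<in> sets borel \<and> b \<in> sets borel}"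
      unfolding sets_R by (simp add: sets_pair_measure)
    show "emeasure ?L Y = emeasure ?R Y" if Y_in: "Y \<in> {a \<times> b | a b. a \<in> sets borel \<and> b \<in> sets borel}" for Y
    proof -
      obtain A B where Y: "Y = A \<times> B" and [measurable]: "A \<in> sets borel" "B \<in> sets borel"
        using Y_in by auto
      have R: "emeasure ?R Y = (\<integral>\<^sup>+x. indicator A x * emeasure (P (t - s) x) B \<partial>\<mu>)"
      proof -
        have "emeasure ?R Y = (\<integral>\<^sup>+x. emeasure (distr (P (t - s) x) (borel \<Otimes>\<^sub>M borel) (Pair x)) Y \<partial>\<mu>)"
          unfolding Y by (rule emeasure_bind[OF _ N]) auto
        also have "\<dots> = (\<integral>\<^sup>+x. indicator A x * emeasure (P (t - s) x) B \<partial>\<mu>)"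
        proof (rule nn_integral_cong)
          fix x
          have "Pair x \<in> P (t - s) x \<rightarrow>\<^sub>M borel \<Otimes>\<^sub>M borel"
            using sets_P[OF ts] by (simp cong: measurable_cong_sets)
          moreover have "Pair x -` (A \<times> B) = (if x \<in> A then B else {})"
            by auto
          ultimately show "emeasure (distr (P (t - s) x) (borel \<Otimes>\<^sub>M borel) (Pair x)) Y = indicator A x * emeasure (P (t - s) x) B"
            unfolding Y by (simp add: emeasure_distr space_P[OF ts])
        qed
        finally show ?thesis .
      qed
      have "measure M (X s -` A \<inter> X t -` B \<inter> space M) = enn2real (emeasure ?R Y)"
        using measure_X_pair[OF s ts _ _ law_X[OF s], of A B] integral_indicator_measure_P[OF ts, of A B] by (simp add: R)
      \<comment> \<open>The comparison passes through \<open>enn2real\<close>, which sends infinity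
        to 0; finiteness makes it faithful.\<close>
      moreover have "emeasure ?R Y < \<infinity>"
      proof -
        have "subprob_space ?R"
          by (rule subprob_space_bind[OF _ N])
            (use mu_prob in \<open>auto simp: space_prob_algebra prob_space_imp_subprob_space\<close>)
        then show ?thesis
          using finite_measure.emeasure_finite[of ?R Y] by (auto simp: subprob_space_def less_top)
      qed
      moreover have "(\<lambda>\<omega>. (X s \<omega>, X t \<omega>)) -` Y \<inter> space M = X s -` A \<inter> X t -` B \<inter> space M"
        unfolding Y by auto
      ultimately show ?thesis
        unfolding Y by (simp add: emeasure_distr M.emeasure_eq_measure)
    qed
    show "range (\<lambda>_::nat. UNIV) \<subseteq> {a \<times> b | a b. a \<in> sets (borel :: 'a measure) \<and> b \<in> sets (borel :: 'a measure)}"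
      by (auto intro!: exI[of _ UNIV])
    show "emeasure ?L UNIV \<noteq> \<infinity>" for i :: nat
    proof -
      interpret L: prob_space ?L
        by (rule M.prob_space_distr) measurable
      show ?thesis
        by simp
    qed
  qed auto
qed

text \<open>Integration against the two-time law, with the later factor averaged first. Asking for
  integrability of the product instead of bounded factors admits \<open>u\<close> or
  \<open>v\<close> equal to \<open>chi\<close>.\<close>

lemma integral_X_pair:
  fixes u v :: "'a \<Rightarrow> real"
  assumes s: "0 \<le> s" and st: "s \<le> t"
    and [measurable]: "u \<in> borel_measurable borel" "v \<in> borel_measurable borel"
    and int: "integrable M (\<lambda>\<omega>. u (X s \<omega>) * v (X t \<omega>))"
  shows "(\<integral>\<omega>. u (X s \<omega>) * v (X t \<omega>) \<partial>M) = (\<integral>x. u x * Pf P (t - s) v x \<partial>\<mu>)"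
proof -
  have ts: "0 \<le> t - s"
    using st by simp
  have [measurable]: "X s \<in> M \<rightarrow>\<^sub>M borel" "X t \<in> M \<rightarrow>\<^sub>M borel"
    using Xmeas s st by auto
  let ?F = "\<lambda>z. u (fst z) * v (snd z)"
  let ?L = "distr M (borel \<Otimes>\<^sub>M borel) (\<lambda>\<omega>. (X s \<omega>, X t \<omega>))"
  have "integrable ?L ?F"
    using int by (subst integrable_distr_eq) auto
  note bind = integral_bind_kernel[OF measurable_pair_kernel[OF s st], of ?F, folded law_X_pair[OF s st], OF _ this]
  have "(\<integral>\<omega>. u (X s \<omega>) * v (X t \<omega>) \<partial>M) = (\<integral>z. ?F z \<partial>?L)"
    by (subst integral_distr) auto
  also have "\<dots> = (\<integral>x. \<integral>z. ?F z \<partial>distr (P (t - s) x) (borel \<Otimes>\<^sub>M borel) (Pair x) \<partial>\<mu>)"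
    by (rule bind[symmetric]) measurable
  also have "\<dots> = (\<integral>x. u x * Pf P (t - s) v x \<partial>\<mu>)"
  proof (rule Bochner_Integration.integral_cong[OF refl])
    fix x
    have Px: "Pair x \<in> P (t - s) x \<rightarrow>\<^sub>M borel \<Otimes>\<^sub>M borel"
      using sets_P[OF ts] by (simp cong: measurable_cong_sets)
    have "(\<integral>z. ?F z \<partial>distr (P (t - s) x) (borel \<Otimes>\<^sub>M borel) (Pair x)) = (\<integral>y. ?F (x, y) \<partial>P (t - s) x)"
      by (rule integral_distr[OF Px]) measurable
    then show "(\<integral>z. ?F z \<partial>distr (P (t - s) x) (borel \<Otimes>\<^sub>M borel) (Pair x)) = u x * Pf P (t - s) v x"
      by (simp add: Pf_def)
  qed
  finally show ?thesis .
qed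

text \<open>The truncation at time \<open>0\<close> makes the process measurable on the whole real time axis.\<close>
lemma measurable_X_truncated: "(\<lambda>(t, \<omega>). X (max 0 t) \<omega>) \<in> borel_measurable (lborel \<Otimes>\<^sub>M M)"
proof -
  have "(\<lambda>z. (max (0 :: real) (fst z), snd z)) \<in> lborel \<Otimes>\<^sub>M M \<rightarrow>\<^sub>M restrict_space lborel {0..} \<Otimes>\<^sub>M M"
    by (intro measurable_Pair measurable_restrict_space2) auto
  from measurable_compose[OF this Xjoint] show ?thesis
    by (simp add: case_prod_beta')
qed

end

section \<open>Moments of the time average\<close>

locale stationary_observable = mixing_observable P \<mu> f W K \<gamma> + stationary_markov_process P \<mu> M X
  for P :: "real \<Rightarrow> 'a::polish_space \<Rightarrow> 'a measure" and \<mu> :: "'a measure"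
    and f W :: "'a \<Rightarrow> real" and K \<gamma> :: real
    and M :: "'w measure" and X :: "real \<Rightarrow> 'w \<Rightarrow> 'a"
begin

definition Y :: "real \<Rightarrow> 'w \<Rightarrow> real" where
  "Y t \<omega> = f (X (max 0 t) \<omega>)"

lemma measurable_Y: "(\<lambda>(t, \<omega>). Y t \<omega>) \<in> borel_measurable (lborel \<Otimes>\<^sub>M M)"
  using measurable_compose[OF measurable_X_truncated f_meas] by (simp add: Y_def case_prod_beta')

lemma Y_le: "\<bar>Y t \<omega>\<bar> \<le> K"
  by (simp add: Y_def f_le)

lemma measurable_Y_fst: "\<omega> \<in> space M \<Longrightarrow> (\<lambda>t. Y t \<omega>) \<in> borel_measurable lborel"
  using measurable_compose[OF measurable_Pair2'[of \<omega> M lborel] measurable_Y] by simp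

lemma sigma_finite_M: "sigma_finite_measure M" and sigma_finite_mu: "sigma_finite_measure \<mu>"
  using prob prob_space_mu by (auto simp: prob_space_def finite_measure_def)

lemma integrable_mult_f:
  assumes "integrable \<mu> u"
  shows "integrable \<mu> (\<lambda>x. f x * u x)"
  by (rule Bochner_Integration.integrable_bound[OF integrable_mult_right[OF assms, of K]])
    (use f_le K_nonneg assms in \<open>auto simp: abs_mult intro!: mult_right_mono\<close>)

lemma integrable_mult_X:
  fixes u v :: "'a \<Rightarrow> real"
  assumes "0 \<le> s" "0 \<le> t" and [measurable]: "u \<in> borel_measurable borel" "v \<in> borel_measurable borel"
    and "integrable \<mu> (\<lambda>x. (u x)\<^sup>2)" "integrable \<mu> (\<lambda>x. (v x)\<^sup>2)"
  shows "integrable M (\<lambda>\<omega>. u (X s \<omega>) * v (X t \<omega>))"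
proof -
  have [measurable]: "X s \<in> M \<rightarrow>\<^sub>M borel" "X t \<in> M \<rightarrow>\<^sub>M borel"
    using Xmeas assms by auto
  have "integrable M (\<lambda>\<omega>. (u (X s \<omega>))\<^sup>2)" "integrable M (\<lambda>\<omega>. (v (X t \<omega>))\<^sup>2)"
    using assms integrable_X[of s "\<lambda>x. (u x)\<^sup>2"] integrable_X[of t "\<lambda>x. (v x)\<^sup>2"] by auto
  then show ?thesis
  proof (rule Bochner_Integration.integrable_bound[OF Bochner_Integration.integrable_add])
    have "\<bar>a * b\<bar> \<le> a\<^sup>2 + b\<^sup>2" for a b :: real
    proof -
      have "0 \<le> \<bar>a\<bar> * \<bar>b\<bar>" and "2 * \<bar>a\<bar> * \<bar>b\<bar> \<le> a\<^sup>2 + b\<^sup>2"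
        using sum_squares_bound[of "\<bar>a\<bar>" "\<bar>b\<bar>"] by auto
      then show ?thesis
        unfolding abs_mult by linarith
    qed
    then show "AE \<omega> in M. norm (u (X s \<omega>) * v (X t \<omega>)) \<le> norm ((u (X s \<omega>))\<^sup>2 + (v (X t \<omega>))\<^sup>2)"
      by simp
  qed measurable
qed

text \<open>After Fubini the two-time law replaces \<open>f (X t)\<close> by
  \<open>P (t - s) f\<close> under \<open>\<mu>\<close>; shifting time and applying Fubini back
  gives the integral of \<open>P r f\<close> over \<open>{0..b - s}\<close>, which is
  \<open>chi - P (b - s) chi\<close>. It is applied with \<open>u = f\<close> for the square of
  \<open>Z\<close> and with \<open>u = chi\<close> for the product with
  \<open>chi (X 0)\<close>.\<close>

lemma time_average:
  assumes sb: "0 \<le> s" "s \<le> b" and [measurable]: "u \<in> borel_measurable borel"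
    and u2: "integrable \<mu> (\<lambda>x. (u x)\<^sup>2)"
  shows "integrable M (\<lambda>\<omega>. u (X s \<omega>) * (\<integral>t. indicator {s..b} t * Y t \<omega> \<partial>lborel))"
    and "(\<integral>\<omega>. u (X s \<omega>) * (\<integral>t. indicator {s..b} t * Y t \<omega> \<partial>lborel) \<partial>M) =
      (\<integral>x. u x * (chi x - Pf P (b - s) chi x) \<partial>\<mu>)"
proof -
  interpret \<mu>: prob_space \<mu> by (rule prob_space_mu)
  have u: "integrable \<mu> u"
    by (rule \<mu>.square_integrable_imp_integrable) (use u2 in auto)
  then have uX: "integrable M (\<lambda>\<omega>. u (X s \<omega>))"
    using integrable_X[of s u] sb by simp
  note avg = Fubini_time_average[OF sigma_finite_M uX measurable_Y Y_le, of s b]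
  show "integrable M (\<lambda>\<omega>. u (X s \<omega>) * (\<integral>t. indicator {s..b} t * Y t \<omega> \<partial>lborel))"
    by (rule avg)
  have mq: "(\<lambda>(t, x). q t x) \<in> borel_measurable (lborel \<Otimes>\<^sub>M \<mu>)"
    by measurable
  note avg_q = Fubini_time_average[OF sigma_finite_mu u mq q_le, of 0 "b - s"]
  have "(\<integral>\<omega>. u (X s \<omega>) * (\<integral>t. indicator {s..b} t * Y t \<omega> \<partial>lborel) \<partial>M) =
      (\<integral>t. indicator {s..b} t * (\<integral>\<omega>. u (X s \<omega>) * Y t \<omega> \<partial>M) \<partial>lborel)"
    by (rule avg)
  also have "\<dots> = (\<integral>t. indicator {s..b} (s + t) * (\<integral>\<omega>. u (X s \<omega>) * Y (s + t) \<omega> \<partial>M) \<partial>lborel)"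
    by (rule lborel_shift[symmetric])
  also have "\<dots> = (\<integral>t. indicator {0..b - s} t * (\<integral>x. u x * q t x \<partial>\<mu>) \<partial>lborel)"
  proof (rule Bochner_Integration.integral_cong[OF refl])
    fix t :: real
    have "(\<integral>\<omega>. u (X s \<omega>) * Y (s + t) \<omega> \<partial>M) = (\<integral>x. u x * q t x \<partial>\<mu>)" if "t \<ge> 0"
      using integral_X_pair[of s "s + t" u f] integrable_mult_X[of s "s + t" u f] that sb u2 integrable_f2(1)
      by (simp add: Y_def q_def)
    then show "indicator {s..b} (s + t) * (\<integral>\<omega>. u (X s \<omega>) * Y (s + t) \<omega> \<partial>M) =
        indicator {0..b - s} t * (\<integral>x. u x * q t x \<partial>\<mu>)"
      by (auto simp: indicator_def)
  qed
  also have "\<dots> = (\<integral>x. u x * (\<integral>t. indicator {0..b - s} t * q t x \<partial>lborel) \<partial>\<mu>)"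
    by (rule avg_q(3)[symmetric])
  finally show "(\<integral>\<omega>. u (X s \<omega>) * (\<integral>t. indicator {s..b} t * Y t \<omega> \<partial>lborel) \<partial>M) =
      (\<integral>x. u x * (chi x - Pf P (b - s) chi x) \<partial>\<mu>)"
    using sb by (simp add: chi_minus_Pf_chi)
qed

definition Z :: "'w \<Rightarrow> real" where
  "Z \<omega> = (\<integral>t. indicator {0..1} t * Y t \<omega> \<partial>lborel)"

lemma Z_eq: "(LBINT s:{0..1}. f (X s \<omega>)) = Z \<omega>"
  unfolding Z_def set_lebesgue_integral_def Y_def
  by (intro Bochner_Integration.integral_cong) (auto simp: indicator_def)

lemma Pf_chi_mu: "t \<ge> 0 \<Longrightarrow> integrable \<mu> (Pf P t chi)"
  by (rule integrable_Pf_mu) (auto simp: integrable_chi_mu)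

text \<open>Never evaluated: it enters the expectation of the square of \<open>Z\<close> and that of
  twice \<open>chi (X 1) * Z\<close> with opposite signs.\<close>

definition J :: real where
  "J = (\<integral>s. indicator {0..1} s * (\<integral>x. f x * Pf P (1 - s) chi x \<partial>\<mu>) \<partial>lborel)"

text \<open>Here \<open>chi\<close> sits at the final time, so \<open>f (X s)\<close> is the earlier
  factor and the kernel \<open>P (1 - s)\<close> acts on \<open>chi\<close> instead of
  \<open>f\<close>.\<close>

lemma time_average_chi_X1:
  shows "integrable M (\<lambda>\<omega>. chi (X 1 \<omega>) * Z \<omega>)"
    and "(\<integral>\<omega>. chi (X 1 \<omega>) * Z \<omega> \<partial>M) = J"
    and "integrable lborel (\<lambda>s. indicator {0..1} s * (\<integral>x. f x * Pf P (1 - s) chi x \<partial>\<mu>))"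
proof -
  have chiX: "integrable M (\<lambda>\<omega>. chi (X 1 \<omega>))"
    using integrable_X[of 1 chi] integrable_chi_mu by simp
  note avg = Fubini_time_average[OF sigma_finite_M chiX measurable_Y Y_le, of 0 1, folded Z_def]
  show "integrable M (\<lambda>\<omega>. chi (X 1 \<omega>) * Z \<omega>)"
    by (rule avg)
  have eq: "indicator {0..1} s * (\<integral>\<omega>. chi (X 1 \<omega>) * Y s \<omega> \<partial>M) =
      indicator {0..1} s * (\<integral>x. f x * Pf P (1 - s) chi x \<partial>\<mu>)" for s :: real
    using integral_X_pair[of s 1 f chi] integrable_mult_X[of s 1 f chi] integrable_chi2_mu integrable_f2(1)
    by (auto simp: Y_def indicator_def mult.commute)
  show "(\<integral>\<omega>. chi (X 1 \<omega>) * Z \<omega> \<partial>M) = J"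
    unfolding avg(3) J_def eq ..
  show "integrable lborel (\<lambda>s. indicator {0..1} s * (\<integral>x. f x * Pf P (1 - s) chi x \<partial>\<mu>))"
    using avg(2) unfolding eq .
qed

text \<open>Pathwise, the square is twice an integral over ordered pairs of times. For fixed earlier
  time \<open>s\<close> the expectation is given by \<open>time_average\<close> with
  \<open>u = f\<close>, and integrating over \<open>s\<close> produces \<open>J\<close>.\<close>

lemma time_average_square:
  shows "integrable M (\<lambda>\<omega>. (Z \<omega>)\<^sup>2)"
    and "(\<integral>\<omega>. (Z \<omega>)\<^sup>2 \<partial>M) = 2 * ((\<integral>x. f x * chi x \<partial>\<mu>) - J)"
proof -
  interpret M: prob_space M by (rule prob)
  \<comment> \<open>For \<open>s \<ge> 0\<close> the inner integral is over \<open>{s..1}\<close>.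
    The additional factor \<open>indicator {0..1} t\<close> keeps it bounded by \<open>K\<close> for
    negative \<open>s\<close> too, as Fubini is used with a bound for all times.\<close>
  define h where "h s \<omega> = Y s \<omega> * (\<integral>t. (if s \<le> t \<and> t \<le> 1 then 1 else 0) * (indicator {0..1} t * Y t \<omega>) \<partial>lborel)" for s \<omega>
  have h_eq: "h s \<omega> = Y s \<omega> * (\<integral>t. indicator {s..1} t * Y t \<omega> \<partial>lborel)" if "0 \<le> s" for s \<omega>
  proof -
    have "(\<lambda>t. (if s \<le> t \<and> t \<le> 1 then 1 else 0) * (indicator {0..1} t * Y t \<omega>)) = (\<lambda>t. indicator {s..1} t * Y t \<omega>)"
      using that by (auto simp: indicator_def)
    then show ?thesis
      by (simp add: h_def)
  qed
  note [measurable] = measurable_Y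
  have mh: "(\<lambda>(s, \<omega>). h s \<omega>) \<in> borel_measurable (lborel \<Otimes>\<^sub>M M)"
    unfolding h_def by measurable
  have int_Y: "integrable lborel (\<lambda>t. indicator {0..1} t * Y t \<omega>)" if "\<omega> \<in> space M" for \<omega>
  proof (rule Bochner_Integration.integrable_bound)
    show "integrable lborel (\<lambda>t. indicator {0..1::real} t * K)"
      by (intro integrable_mult_left integrable_real_indicator) auto
    show "AE t in lborel. norm (indicator {0..1} t * Y t \<omega>) \<le> norm (indicator {0..1} t * K)"
      using Y_le K_nonneg by (auto simp: indicator_def)
  qed (use measurable_Y_fst[OF that] in measurable)
  have bound: "\<bar>h s \<omega>\<bar> \<le> K * K" for s \<omega>
  proof -
    let ?g = "\<lambda>t. (if s \<le> t \<and> t \<le> 1 then 1 else 0) * (indicator {0..1} t * Y t \<omega>)"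
    have "\<bar>\<integral>t. ?g t \<partial>lborel\<bar> \<le> K"
    \<comment> \<open>Paths are known to be measurable only for \<open>\<omega>\<close> in
      \<open>space M\<close>; elsewhere the integral may take its default value 0, which also obeys
      the bound.\<close>
    proof (cases "integrable lborel ?g")
      case True
      have "\<bar>\<integral>t. ?g t \<partial>lborel\<bar> \<le> (\<integral>t. \<bar>?g t\<bar> \<partial>lborel)"
        by (rule integral_abs_bound)
      also have "\<dots> \<le> (\<integral>t. indicator {0..1::real} t * K \<partial>lborel)"
      proof (rule integral_mono)
        show "integrable lborel (\<lambda>t. indicator {0..1::real} t * K)"
          by (intro integrable_mult_left integrable_real_indicator) auto
        show "\<bar>?g t\<bar> \<le> indicator {0..1} t * K" for t
          using Y_le K_nonneg by (auto simp: indicator_def)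
      qed (use True in auto)
      finally show ?thesis
        by simp
    qed (simp add: not_integrable_integral_eq K_nonneg)
    then show ?thesis
      unfolding h_def abs_mult using Y_le K_nonneg by (intro mult_mono) auto
  qed
  have one: "integrable M (\<lambda>_. 1 :: real)"
    by simp
  note avg = Fubini_time_average[OF sigma_finite_M one mh bound, of 0 1, simplified]
  have sq: "(Z \<omega>)\<^sup>2 = 2 * (\<integral>s. indicator {0..1} s * h s \<omega> \<partial>lborel)" if "\<omega> \<in> space M" for \<omega>
  proof -
    have "(Z \<omega>)\<^sup>2 = 2 * (\<integral>s. indicator {0..1} s * Y s \<omega> *
        (\<integral>t. indicator {s..} t * (indicator {0..1} t * Y t \<omega>) \<partial>lborel) \<partial>lborel)"
      unfolding Z_def by (rule square_lborel_integral[OF int_Y[OF that]])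
    also have "(\<lambda>s. indicator {0..1} s * Y s \<omega> * (\<integral>t. indicator {s..} t * (indicator {0..1} t * Y t \<omega>) \<partial>lborel)) =
        (\<lambda>s. indicator {0..1} s * h s \<omega>)"
    proof
      fix s :: real
      have "(\<lambda>t. indicator {s..} t * (indicator {0..1} t * Y t \<omega>)) =
          (\<lambda>t. (if s \<le> t \<and> t \<le> 1 then 1 else 0) * (indicator {0..1} t * Y t \<omega>))"
        by (auto simp: indicator_def)
      then show "indicator {0..1} s * Y s \<omega> * (\<integral>t. indicator {s..} t * (indicator {0..1} t * Y t \<omega>) \<partial>lborel) =
          indicator {0..1} s * h s \<omega>"
        by (simp add: h_def)
    qed
    finally show ?thesis .
  qed
  have "integrable M (\<lambda>\<omega>. 2 * (\<integral>s. indicator {0..1} s * h s \<omega> \<partial>lborel))"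
    using avg(1) by simp
  then show "integrable M (\<lambda>\<omega>. (Z \<omega>)\<^sup>2)"
    by (rule Bochner_Integration.integrable_cong[THEN iffD2, rotated -1]) (auto simp: sq)
  have "(\<integral>\<omega>. (Z \<omega>)\<^sup>2 \<partial>M) = (\<integral>\<omega>. 2 * (\<integral>s. indicator {0..1} s * h s \<omega> \<partial>lborel) \<partial>M)"
    by (intro Bochner_Integration.integral_cong) (auto simp: sq)
  also have "\<dots> = 2 * (\<integral>s. indicator {0..1} s * (\<integral>\<omega>. h s \<omega> \<partial>M) \<partial>lborel)"
    using avg(3) by simp
  also have "(\<integral>s. indicator {0..1} s * (\<integral>\<omega>. h s \<omega> \<partial>M) \<partial>lborel) =
      (\<integral>s. indicator {0..1} s * (\<integral>x. f x * chi x \<partial>\<mu>) - indicator {0..1} s * (\<integral>x. f x * Pf P (1 - s) chi x \<partial>\<mu>) \<partial>lborel)"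
  proof (rule Bochner_Integration.integral_cong[OF refl])
    fix s :: real
    have "(\<integral>\<omega>. h s \<omega> \<partial>M) = (\<integral>x. f x * chi x \<partial>\<mu>) - (\<integral>x. f x * Pf P (1 - s) chi x \<partial>\<mu>)" if s: "0 \<le> s" "s \<le> 1"
    proof -
      have "(\<integral>\<omega>. h s \<omega> \<partial>M) = (\<integral>x. f x * (chi x - Pf P (1 - s) chi x) \<partial>\<mu>)"
        using time_average(2)[OF s f_meas integrable_f2(1)] s by (simp add: h_eq Y_def[of s])
      also have "\<dots> = (\<integral>x. f x * chi x \<partial>\<mu>) - (\<integral>x. f x * Pf P (1 - s) chi x \<partial>\<mu>)"
        using integrable_mult_f[OF integrable_chi_mu] integrable_mult_f[OF Pf_chi_mu[of "1 - s"]] s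
        by (simp add: right_diff_distrib)
      finally show ?thesis .
    qed
    then show "indicator {0..1} s * (\<integral>\<omega>. h s \<omega> \<partial>M) =
        indicator {0..1} s * (\<integral>x. f x * chi x \<partial>\<mu>) - indicator {0..1} s * (\<integral>x. f x * Pf P (1 - s) chi x \<partial>\<mu>)"
      by (auto simp: indicator_def)
  qed
  also have "\<dots> = (\<integral>x. f x * chi x \<partial>\<mu>) - J"
    unfolding J_def using time_average_chi_X1(3)
    by (subst Bochner_Integration.integral_diff) (auto intro!: integrable_mult_left integrable_real_indicator)
  finally show "(\<integral>\<omega>. (Z \<omega>)\<^sup>2 \<partial>M) = 2 * ((\<integral>x. f x * chi x \<partial>\<mu>) - J)" .
qed

text \<open>The two squares of \<open>chi\<close> and their cross term contribute
  \<open>2 * (?c - ?p)\<close>, cancelled by the product of \<open>chi (X 0)\<close> with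
  \<open>Z\<close>; the terms \<open>2 * J\<close> cancel as well.\<close>

theorem variance_identity:
  "(\<integral>\<omega>. (chi (X 1 \<omega>) - chi (X 0 \<omega>) + (LBINT s:{0..1}. f (X s \<omega>)))\<^sup>2 \<partial>M) = 2 * (\<integral>x. chi x * f x \<partial>\<mu>)"
proof -
  let ?a = "\<lambda>\<omega>. chi (X 1 \<omega>)" and ?b = "\<lambda>\<omega>. chi (X 0 \<omega>)"
  let ?c = "\<integral>x. (chi x)\<^sup>2 \<partial>\<mu>" and ?p = "\<integral>x. chi x * Pf P 1 chi x \<partial>\<mu>"
  have a2: "integrable M (\<lambda>\<omega>. (?a \<omega>)\<^sup>2)" "(\<integral>\<omega>. (?a \<omega>)\<^sup>2 \<partial>M) = ?c"
    and b2: "integrable M (\<lambda>\<omega>. (?b \<omega>)\<^sup>2)" "(\<integral>\<omega>. (?b \<omega>)\<^sup>2 \<partial>M) = ?c"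
    using integrable_chi2_mu integral_X[of _ "\<lambda>x. (chi x)\<^sup>2"] integrable_X[of _ "\<lambda>x. (chi x)\<^sup>2"] by auto
  have ab: "integrable M (\<lambda>\<omega>. ?b \<omega> * ?a \<omega>)"
    using integrable_mult_X[of 0 1 chi chi] integrable_chi2_mu by simp
  then have ab': "(\<integral>\<omega>. ?b \<omega> * ?a \<omega> \<partial>M) = ?p"
    using integral_X_pair[of 0 1 chi chi] by simp
  have bZ: "integrable M (\<lambda>\<omega>. ?b \<omega> * Z \<omega>)"
    and bZ': "(\<integral>\<omega>. ?b \<omega> * Z \<omega> \<partial>M) = (\<integral>x. chi x * (chi x - Pf P 1 chi x) \<partial>\<mu>)"
    using time_average[of 0 1 chi] integrable_chi2_mu by (simp_all add: Z_def)
  \<comment> \<open>The bounded increment gives the majorant \<open>\<bar>chi x\<bar> * K\<close>;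
    subtracting this product from the square of \<open>chi\<close> leaves exactly the integrand of
    \<open>?p\<close>.\<close>
  have "integrable \<mu> (\<lambda>x. chi x * (chi x - Pf P 1 chi x))"
  proof (rule Bochner_Integration.integrable_bound[OF integrable_mult_left[OF integrable_chi_mu, of K]])
    show "AE x in \<mu>. norm (chi x * (chi x - Pf P 1 chi x)) \<le> norm (chi x * K)"
      using chi_minus_Pf_chi_le[of 1] K_nonneg by (auto simp: abs_mult intro!: mult_left_mono)
  qed measurable
  from Bochner_Integration.integral_diff[OF integrable_chi2_mu this]
  have "(\<integral>x. (chi x)\<^sup>2 - chi x * (chi x - Pf P 1 chi x) \<partial>\<mu>) = ?c - (\<integral>x. chi x * (chi x - Pf P 1 chi x) \<partial>\<mu>)" .
  then have bZ_p: "(\<integral>\<omega>. ?b \<omega> * Z \<omega> \<partial>M) = ?c - ?p"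
    unfolding bZ' by (simp add: power2_eq_square right_diff_distrib)
  have "(?a \<omega> - ?b \<omega> + Z \<omega>)\<^sup>2 = (?a \<omega>)\<^sup>2 + (?b \<omega>)\<^sup>2 + (Z \<omega>)\<^sup>2 + 2 * (?a \<omega> * Z \<omega>) - 2 * (?b \<omega> * ?a \<omega>) - 2 * (?b \<omega> * Z \<omega>)" for \<omega>
    by (simp add: power2_eq_square algebra_simps)
  then have "(\<integral>\<omega>. (?a \<omega> - ?b \<omega> + Z \<omega>)\<^sup>2 \<partial>M) =
      ?c + ?c + 2 * ((\<integral>x. f x * chi x \<partial>\<mu>) - J) + 2 * J - 2 * ?p - 2 * (?c - ?p)"
    using a2 b2 time_average_square time_average_chi_X1(1,2) ab ab' bZ bZ_p by simp
  then show ?thesis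
    by (simp add: Z_eq mult.commute)
qed

end

section \<open>The variance formula\<close>

text \<open>The proof verifies the assumptions of \<open>stationary_observable\<close>: convergence
  in \<open>dFM\<close> from Dirac masses gives the decay, the bound on the square of
  \<open>V\<close> gives the integrability of \<open>W\<close>, and continuity near 0 gives the
  right limit.\<close>

theorem theorem4p1:
  fixes M :: "'w measure"
    and X :: "real \<Rightarrow> 'w \<Rightarrow> 'a::polish_space"
    and P :: "real \<Rightarrow> 'a \<Rightarrow> 'a measure"
    and \<mu> :: "'a measure"
    and V g :: "'a \<Rightarrow> real"
    and \<gamma> \<kappa> A B \<Gamma> :: real
    and C :: "'a measure \<Rightarrow> real"
  assumes
    \<comment> \<open>transition semigroup (Markov kernels)\<close>
    kernel: "\<And>t. t \<ge> 0 \<Longrightarrow> P t \<in> borel \<rightarrow>\<^sub>M prob_algebra borel"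
    and P0: "\<And>x. P 0 x = return borel x"
    and semigroup: "\<And>s t x. s \<ge> 0 \<Longrightarrow> t \<ge> 0 \<Longrightarrow> P (s + t) x = P s x \<bind> P t"
    \<comment> \<open>the process: jointly measurable, time-homogeneous Markov with semigroup P\<close>
    and prob: "prob_space M"
    and Xmeas: "\<And>t. t \<ge> 0 \<Longrightarrow> X t \<in> M \<rightarrow>\<^sub>M borel"
    and Xjoint: "(\<lambda>(t, \<omega>). X t \<omega>) \<in> borel_measurable (restrict_space lborel {0..} \<Otimes>\<^sub>M M)"
    and markov: "\<And>s t Bs E. s \<ge> 0 \<Longrightarrow> t \<ge> 0 \<Longrightarrow> Bs \<in> sets borel \<Longrightarrow> E \<in> sets (nat_filt M X s) \<Longrightarrow>
        measure M (E \<inter> X (s + t) -` Bs \<inter> space M) = (LINT \<omega>:E|M. measure (P t (X s \<omega>)) Bs)"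
    \<comment> \<open>initial distribution mu\<close>
    and init: "distr M borel (X 0) = \<mu>"
    \<comment> \<open>(a) unique invariant probability measure mu, exponential convergence in d_FM\<close>
    and mu_prob: "\<mu> \<in> space (prob_algebra borel)"
    and mu_inv: "\<And>t. t \<ge> 0 \<Longrightarrow> \<mu> \<bind> P t = \<mu>"
    and mu_unique: "\<And>\<nu>. \<nu> \<in> space (prob_algebra borel) \<Longrightarrow> (\<forall>t\<ge>0. \<nu> \<bind> P t = \<nu>) \<Longrightarrow> \<nu> = \<mu>"
    and V_cont: "continuous_on UNIV V"
    and V_nonneg: "\<And>x. V x \<ge> 0"
    and \<gamma>_pos: "\<gamma> > 0"
    and \<kappa>_pos: "\<kappa> > 0"
    and C_nonneg: "\<And>\<nu>. \<nu> \<in> space (prob_algebra borel) \<Longrightarrow> (\<integral>\<^sup>+ x. ennreal (V x) \<partial>\<nu>) < \<infinity> \<Longrightarrow> C \<nu> \<ge> 0"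
    and conv: "\<And>\<nu> t. \<nu> \<in> space (prob_algebra borel) \<Longrightarrow> (\<integral>\<^sup>+ x. ennreal (V x) \<partial>\<nu>) < \<infinity> \<Longrightarrow> t \<ge> 0 \<Longrightarrow>
        dFM (\<nu> \<bind> P t) \<mu> \<le> C \<nu> * exp (- \<gamma> * t)"
    and C_dirac: "\<And>x. C (return borel x) = \<kappa> * sqrt (V x + 1)"
    \<comment> \<open>(b) Lyapunov-type bound for V^2\<close>
    and AB: "A \<ge> 0" "B \<ge> 0" "\<Gamma> > 0"
    and lyap: "\<And>x t. t \<ge> 0 \<Longrightarrow>
        (\<integral>\<^sup>+ y. ennreal ((V y)\<^sup>2) \<partial>(P t x)) \<le> ennreal (A * exp (- \<Gamma> * t) * (V x)\<^sup>2 + B)"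
    \<comment> \<open>g bounded Lipschitz, t \<mapsto> P(t)g(x) continuous near 0\<close>
    and g_bdd: "bounded (range g)"
    and g_lip: "\<exists>L. L-lipschitz_on UNIV g"
    and g_cont: "\<And>x. \<exists>\<epsilon>>0. continuous_on {0..\<epsilon>} (\<lambda>t. Pf P t g x)"
  shows
    "let gbar = (\<lambda>x. g x - (\<integral>y. g y \<partial>\<mu>));
         chi = (\<lambda>x. LBINT t:{0..}. Pf P t gbar x);
         M1 = (\<lambda>\<omega>. chi (X 1 \<omega>) - chi (X 0 \<omega>) + (LBINT s:{0..1}. gbar (X s \<omega>)));
         \<sigma>2 = (\<integral>\<omega>. (M1 \<omega>)\<^sup>2 \<partial>M)
     in chi \<in> gen_dom P \<mu> \<and>
        \<sigma>2 = - 2 * (\<integral>x. chi x * generator P \<mu> chi x \<partial>\<mu>) \<and>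
        \<sigma>2 = 2 * (\<integral>x. chi x * gbar x \<partial>\<mu>)"
proof -
  interpret invariant_markov_semigroup P \<mu>
    by unfold_locales (use kernel P0 semigroup mu_prob mu_inv in auto)
  obtain L where lip: "L-lipschitz_on UNIV g"
    using g_lip by blast
  obtain c where c: "c > 0" and g_le: "\<And>x. \<bar>g x\<bar> \<le> c" and BL: "BL1 (\<lambda>x. g x / c)"
    using ex_BL1_scaling[OF g_bdd lip] by blast
  define m where "m = (\<integral>y. g y \<partial>\<mu>)"
  define f where "f x = g x - m" for x
  \<comment> \<open>\<open>\<kappa> * sqrt (V x + 1)\<close> is \<open>C\<close> at the Dirac mass
    of \<open>x\<close>; the factor \<open>c\<close> undoes the scaling of \<open>g\<close> to a
    test function of \<open>dFM\<close>.\<close>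
  define W where "W x = c * \<kappa> * sqrt (V x + 1)" for x
  have [measurable]: "g \<in> borel_measurable borel" "V \<in> borel_measurable borel"
    using lipschitz_on_continuous_on[OF lip] V_cont by (auto intro: borel_measurable_continuous_onI)
  have g_int: "integrable (P t x) g" if "t \<ge> 0" for t x
    using that g_le by (intro integrable_P_bounded[where K = c]) auto
  have Pf_f: "Pf P t f x = Pf P t g x - m" if t: "t \<ge> 0" for t x
  proof -
    interpret Px: prob_space "P t x" by (rule prob_space_P[OF t])
    show ?thesis
      using g_int[OF t] by (simp add: Pf_def f_def Px.prob_space)
  qed
  have W2: "(W x)\<^sup>2 = (c * \<kappa>)\<^sup>2 * (V x + 1)" for x
    using V_nonneg[of x] by (simp add: W_def power_mult_distrib)
  \<comment> \<open>The square of \<open>W\<close> is affine in \<open>V\<close>, and under a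
    probability measure a square integrable \<open>V\<close> is integrable.\<close>
  have W2_int: "integrable N (\<lambda>x. (W x)\<^sup>2)"
    if N: "prob_space N" "sets N = sets borel" and fin: "(\<integral>\<^sup>+x. ennreal ((V x)\<^sup>2) \<partial>N) < \<infinity>" for N
  proof -
    interpret N: prob_space N by (rule N)
    have [measurable_cong]: "sets N = sets borel" by (rule N)
    have "integrable N V"
      by (rule N.square_integrable_imp_integrable)
        (use fin in \<open>auto simp: integrable_iff_bounded\<close>)
    then show ?thesis
      unfolding W2 by simp
  qed
  \<comment> \<open>The term depending on the starting point decays in time for each
    \<open>x\<close>, so invariance leaves only the constant \<open>B\<close>.\<close>
  have "(\<integral>\<^sup>+x. ennreal ((V x)\<^sup>2) \<partial>\<mu>) \<le> ennreal B"
  proof (rule nn_integral_invariant_le[where c = "\<lambda>t x. A * exp (- \<Gamma> * t) * (V x)\<^sup>2"])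
    have "filterlim (\<lambda>t. - \<Gamma> * t) at_bot at_top"
      by (rule filterlim_tendsto_neg_mult_at_bot[OF tendsto_const _ filterlim_ident]) (use AB(3) in simp)
    then have "((\<lambda>t. exp (- \<Gamma> * t)) \<longlongrightarrow> 0) at_top"
      by (rule filterlim_compose[OF exp_at_bot])
    then have "((\<lambda>t. A * exp (- \<Gamma> * t) * (V x)\<^sup>2) \<longlongrightarrow> A * 0 * (V x)\<^sup>2) at_top" for x
      by (intro tendsto_intros)
    then show "((\<lambda>t. A * exp (- \<Gamma> * t) * (V x)\<^sup>2) \<longlongrightarrow> 0) at_top" for x
      by simp
  qed (use lyap in auto)
  then have V2_mu: "(\<integral>\<^sup>+x. ennreal ((V x)\<^sup>2) \<partial>\<mu>) < \<infinity>"
    by (rule order_le_less_trans) simp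
  have V2_P: "(\<integral>\<^sup>+y. ennreal ((V y)\<^sup>2) \<partial>P t x) < \<infinity>" if "t \<ge> 0" for t x
    using lyap[OF that] by (rule order_le_less_trans) simp
  \<comment> \<open>The convergence hypothesis is used at the Dirac mass of \<open>x\<close>, where
    \<open>V\<close> has the finite integral \<open>V x\<close> and whose image under the kernel is
    \<open>P t x\<close>, and tested on \<open>g / c\<close>.\<close>
  have decay: "\<bar>Pf P t f x\<bar> \<le> exp (- \<gamma> * t) * W x" if t: "t \<ge> 0" for t x
  proof -
    have "return borel x \<in> space (prob_algebra borel)"
      by (auto simp: space_prob_algebra prob_space_return)
    moreover have "(\<integral>\<^sup>+y. ennreal (V y) \<partial>return borel x) < \<infinity>"
      by (subst nn_integral_return) auto
    ultimately have "dFM (return borel x \<bind> P t) \<mu> \<le> \<kappa> * sqrt (V x + 1) * exp (- \<gamma> * t)"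
      using conv[of "return borel x" t] t C_dirac by simp
    also have "return borel x \<bind> P t = P t x"
      by (rule bind_return[OF subprob_kernel[OF t]]) simp
    finally have "\<bar>(\<integral>y. g y / c \<partial>P t x) - (\<integral>y. g y / c \<partial>\<mu>)\<bar> \<le> \<kappa> * sqrt (V x + 1) * exp (- \<gamma> * t)"
      using BL1_integral_diff_le_dFM[OF prob_space_P[OF t] prob_space_mu BL, of x] by linarith
    moreover have "(\<integral>y. g y / c \<partial>P t x) - (\<integral>y. g y / c \<partial>\<mu>) = Pf P t f x / c"
      unfolding Pf_f[OF t] by (simp add: Pf_def m_def diff_divide_distrib)
    ultimately show ?thesis
      using c by (simp add: W_def pos_divide_le_eq mult_ac)
  qed
  have f_cont: "((\<lambda>t. Pf P t f x) \<longlongrightarrow> f x) (at_right 0)" for x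
  proof -
    obtain \<epsilon> where \<epsilon>: "\<epsilon> > 0" "continuous_on {0..\<epsilon>} (\<lambda>t. Pf P t g x)"
      using g_cont by blast
    then have "((\<lambda>t. Pf P t g x) \<longlongrightarrow> Pf P 0 g x) (at_right 0)"
      using continuous_on_Icc_at_rightD by blast
    then have "((\<lambda>t. Pf P t g x - m) \<longlongrightarrow> g x - m) (at_right 0)"
      by (intro tendsto_intros) (simp add: Pf_0)
    moreover have "eventually (\<lambda>t. Pf P t g x - m = Pf P t f x) (at_right 0)"
      by (rule eventually_mono[OF eventually_at_right_less]) (simp add: Pf_f)
    ultimately show ?thesis
      unfolding f_def by (rule Lim_transform_eventually)
  qed
  interpret S: stationary_observable P \<mu> f W "c + \<bar>m\<bar>" \<gamma> M X
  proof (intro stationary_observable.intro mixing_observable.intro mixing_observable_axioms.intro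
      stationary_markov_process.intro stationary_markov_process_axioms.intro)
    show "invariant_markov_semigroup P \<mu>" "invariant_markov_semigroup P \<mu>"
      by (rule invariant_markov_semigroup_axioms)+
    show "\<bar>f x\<bar> \<le> c + \<bar>m\<bar>" for x
      using g_le[of x] by (simp add: f_def)
    show "integrable (P t x) (\<lambda>x. (W x)\<^sup>2)" if "t \<ge> 0" for t x
      by (rule W2_int[OF prob_space_P[OF that] sets_P[OF that] V2_P[OF that]])
    show "f \<in> borel_measurable borel" "W \<in> borel_measurable borel"
      unfolding f_def[abs_def] W_def[abs_def] by measurable
    show "integrable \<mu> (\<lambda>x. (W x)\<^sup>2)"
      by (rule W2_int[OF prob_space_mu sets_mu V2_mu])
  qed (fact f_cont \<gamma>_pos decay prob Xmeas Xjoint markov init)+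
  have f_eq: "g x - (\<integral>y. g y \<partial>\<mu>) = f x" for x
    by (simp add: f_def m_def)
  show ?thesis
    unfolding Let_def f_eq S.chi_def[symmetric]
    using S.chi_in_gen_dom S.variance_identity S.integral_chi_generator by simp
qed

end
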